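(* Let $\xi_{ij}$, $1\le i,j\le n$, be i.i.d. real random variables with mean zero, variance one, and finite fourth moment, and let $M_n$ be the $n\times n$ random matrix with entries $\xi_{ij}$. Then with probability $1-o(1)$, $$|\det M_n| \ge n^{(1/2-o(1))n},$$ where both $o(1)$ terms tend to $0$ as $n\to\infty$. *)

theory Defs
  imports "HOL-Probability.Probability" "Jordan_Normal_Form.Determinant"
begin

end

theory Submission
  imports Defs "HOL-Real_Asymp.Real_Asymp"
begin

text \<open>
  Let \<open>P\<^sub>i\<close> be the orthogonal projection onto the complement of the first \<open>i\<close> rows. Gram--Schmidt
  gives \<open>det\<^sup>2 = \<Prod>\<^sub>i \<bar>P\<^sub>i x\<^sub>i\<bar>\<^sup>2\<close>, where \<open>x\<^sub>i\<close> is independent of \<open>P\<^sub>i\<close>, so every factor is a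
  quadratic form of a random vector in a fixed projection of trace at least \<open>n - i\<close>.
  By the fourth moment the form concentrates around its trace, so by Markov's inequality all but
  \<open>o(n)\<close> factors have order \<open>n\<close>. The exceptional factors may lose any fixed power of \<open>n\<close>. Eliminating
  coordinates one at a time shows that the \<open>i\<close>-th factor is below \<open>1/(4n)\<close> with probability
  exponentially small in \<open>n - i\<close>. This leaves boundedly many last rows. There, a union bound over a
  polynomial grid shows that a normal vector of the previous rows has many coordinates of polynomial
  size, and a Littlewood--Offord estimate applies. The latter is proved by symmetrization: passing
  from \<open>r\<close> to \<open>r + 1\<close> summands compares unions of \<open>k\<close> short intervals with unions of \<open>k \<plusminus> 1\<close> such
  intervals, so that the concentration function is dominated by a survival probability of a random
  walk.
\<close>

section \<open>Projections and the Gram--Schmidt determinant formula\<close>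

text \<open>The law may be discrete, as for random signs, so the matrix can be singular with
  positive probability and no density bound is available. The only anticoncentration of a single
  entry is a mass \<open>c\<close>, depending on the fourth moment alone, outside every interval of
  length 1. This shapes the proof. The elimination bounds for the early rows form a geometric series
  in \<open>n - i\<close>, whose tail is small once a constant number \<open>k\<close> of last rows
  is set aside. For each of these \<open>k\<close> rows the failure probability only has to lie
  below a constant. Hence it suffices that a normal vector has a constant number \<open>m\<close> of
  sizeable coordinates, and the grid then costs a factor n^(5m), up to a constant, against (1 -
  c)^(n div 2). The factors of the determinant are dependent on each other, but only union bounds
  and linearity of expectation are applied to them.\<close>

definition mat_vec :: "nat \<Rightarrow> (nat \<Rightarrow> nat \<Rightarrow> real) \<Rightarrow> (nat \<Rightarrow> real) \<Rightarrow> nat \<Rightarrow> real" where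
  "mat_vec n P x j = (\<Sum>k<n. P j k * x k)"

definition quad_form :: "nat \<Rightarrow> (nat \<Rightarrow> nat \<Rightarrow> real) \<Rightarrow> (nat \<Rightarrow> real) \<Rightarrow> real" where
  "quad_form n P x = (\<Sum>j<n. x j * mat_vec n P x j)"

definition is_proj :: "nat \<Rightarrow> (nat \<Rightarrow> nat \<Rightarrow> real) \<Rightarrow> bool" where
  "is_proj n P \<longleftrightarrow> (\<forall>j<n. \<forall>k<n. P j k = P k j) \<and>
     (\<forall>j<n. \<forall>k<n. (\<Sum>l<n. P j l * P l k) = P j k)"

text \<open>If the quadratic form vanishes at \<open>x\<close>, then so does \<open>P x\<close>, and division by zero leaves \<open>P\<close> unchanged.\<close>

definition deflate :: "nat \<Rightarrow> (nat \<Rightarrow> nat \<Rightarrow> real) \<Rightarrow> (nat \<Rightarrow> real) \<Rightarrow> nat \<Rightarrow> nat \<Rightarrow> real" where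
  "deflate n P x j k = P j k - mat_vec n P x j * mat_vec n P x k / quad_form n P x"

lemma is_proj_sym: "is_proj n P \<Longrightarrow> j < n \<Longrightarrow> k < n \<Longrightarrow> P j k = P k j"
  by (auto simp: is_proj_def)

lemma is_proj_idem: "is_proj n P \<Longrightarrow> j < n \<Longrightarrow> k < n \<Longrightarrow> (\<Sum>l<n. P j l * P l k) = P j k"
  unfolding is_proj_def by blast

lemma mat_vec_adjoint:
  assumes "is_proj n P"
  shows "(\<Sum>j<n. mat_vec n P x j * y j) = (\<Sum>j<n. x j * mat_vec n P y j)"
proof -
  have "(\<Sum>j<n. mat_vec n P x j * y j) = (\<Sum>j<n. \<Sum>k<n. P j k * x k * y j)"
    by (simp add: mat_vec_def sum_distrib_right)
  also have "\<dots> = (\<Sum>k<n. \<Sum>j<n. P j k * x k * y j)" by (rule sum.swap)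
  also have "\<dots> = (\<Sum>k<n. \<Sum>j<n. x k * (P k j * y j))"
    by (intro sum.cong refl) (simp add: is_proj_sym[OF assms])
  also have "\<dots> = (\<Sum>j<n. x j * mat_vec n P y j)"
    by (simp add: mat_vec_def sum_distrib_left)
  finally show ?thesis .
qed

lemma mat_vec_idem:
  assumes "is_proj n P" "j < n"
  shows "mat_vec n P (mat_vec n P x) j = mat_vec n P x j"
proof -
  have "mat_vec n P (mat_vec n P x) j = (\<Sum>l<n. \<Sum>k<n. P j l * P l k * x k)"
    by (simp add: mat_vec_def sum_distrib_left mult.assoc)
  also have "\<dots> = (\<Sum>k<n. \<Sum>l<n. P j l * P l k * x k)" by (rule sum.swap)
  also have "\<dots> = (\<Sum>k<n. (\<Sum>l<n. P j l * P l k) * x k)"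
    by (simp add: sum_distrib_right)
  also have "\<dots> = mat_vec n P x j"
    unfolding mat_vec_def by (intro sum.cong refl) (simp add: is_proj_idem[OF assms(1) assms(2)])
  finally show ?thesis .
qed

lemma quad_form_eq_sum_squares:
  assumes "is_proj n P"
  shows "quad_form n P x = (\<Sum>j<n. (mat_vec n P x j)\<^sup>2)"
proof -
  have "(\<Sum>j<n. mat_vec n P x j * mat_vec n P x j) = (\<Sum>j<n. x j * mat_vec n P (mat_vec n P x) j)"
    by (rule mat_vec_adjoint[OF assms])
  also have "\<dots> = quad_form n P x"
    unfolding quad_form_def by (intro sum.cong refl) (simp add: mat_vec_idem[OF assms])
  finally show ?thesis by (simp add: power2_eq_square)
qed

lemma quad_form_nonneg: "is_proj n P \<Longrightarrow> 0 \<le> quad_form n P x"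
  by (simp add: quad_form_eq_sum_squares sum_nonneg)

lemma mat_vec_eq_0_if_quad_form_eq_0:
  assumes "is_proj n P" "quad_form n P x = 0" "j < n"
  shows "mat_vec n P x j = 0"
  using assms by (simp add: quad_form_eq_sum_squares sum_nonneg_eq_0_iff)

lemma mat_vec_square_le_quad_form:
  assumes "is_proj n P" "j < n"
  shows "(mat_vec n P x j)\<^sup>2 \<le> quad_form n P x"
  unfolding quad_form_eq_sum_squares[OF assms(1)]
  using assms by (intro member_le_sum[where f="\<lambda>j. (mat_vec n P x j)\<^sup>2"]) auto

lemma mat_vec_deflate:
  "mat_vec n (deflate n P x) y j =
     mat_vec n P y j - mat_vec n P x j * (\<Sum>k<n. mat_vec n P x k * y k) / quad_form n P x"
proof -
  have "mat_vec n (deflate n P x) y j =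
      (\<Sum>k<n. P j k * y k - mat_vec n P x j / quad_form n P x * (mat_vec n P x k * y k))"
    unfolding mat_vec_def[of n "deflate n P x"] deflate_def
    by (intro sum.cong refl) (simp add: algebra_simps)
  also have "\<dots> = mat_vec n P y j - mat_vec n P x j / quad_form n P x * (\<Sum>k<n. mat_vec n P x k * y k)"
    unfolding sum_subtractf sum_distrib_left[symmetric] mat_vec_def[of n P y] ..
  finally show ?thesis by simp
qed

lemma is_proj_deflate:
  assumes P: "is_proj n P"
  shows "is_proj n (deflate n P x)"
proof -
  let ?a = "mat_vec n P x" and ?q = "quad_form n P x"
  have "(\<Sum>l<n. deflate n P x j l * deflate n P x l k) = deflate n P x j k" if "j < n" "k < n" for j k
  proof -
    have 1: "(\<Sum>l<n. P j l * ?a l) = ?a j"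
      using mat_vec_idem[OF P that(1), of x] by (simp add: mat_vec_def)
    have "(\<Sum>l<n. ?a l * P l k) = (\<Sum>l<n. P k l * ?a l)"
      by (intro sum.cong refl) (use is_proj_sym[OF P] that in \<open>simp add: mult.commute\<close>)
    then have 2: "(\<Sum>l<n. ?a l * P l k) = ?a k"
      using mat_vec_idem[OF P that(2), of x] by (simp add: mat_vec_def)
    have 3: "(\<Sum>l<n. ?a l * ?a l) = ?q"
      by (simp add: quad_form_eq_sum_squares[OF P] power2_eq_square)
    have "(\<Sum>l<n. deflate n P x j l * deflate n P x l k) =
      (\<Sum>l<n. P j l * P l k - ?a k / ?q * (P j l * ?a l) - ?a j / ?q * (?a l * P l k)
          + ?a j * ?a k / ?q / ?q * (?a l * ?a l))"
      unfolding deflate_def by (intro sum.cong refl) (simp add: algebra_simps)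
    also have "\<dots> = P j k - ?a k / ?q * ?a j - ?a j / ?q * ?a k + ?a j * ?a k / ?q / ?q * ?q"
      unfolding sum.distrib sum_subtractf sum_distrib_left[symmetric] 1 2 3 is_proj_idem[OF P that] ..
    also have "\<dots> = deflate n P x j k"
      by (simp add: deflate_def)
    finally show ?thesis .
  qed
  moreover have "deflate n P x j k = deflate n P x k j" if "j < n" "k < n" for j k
    using is_proj_sym[OF P that] by (simp add: deflate_def mult.commute)
  ultimately show ?thesis unfolding is_proj_def by blast
qed

lemma trace_deflate:
  assumes "is_proj n P"
  shows "(\<Sum>j<n. deflate n P x j j) = (\<Sum>j<n. P j j) - (if quad_form n P x = 0 then 0 else 1)"
proof -
  have "(\<Sum>j<n. deflate n P x j j) = (\<Sum>j<n. P j j) - (\<Sum>j<n. (mat_vec n P x j)\<^sup>2) / quad_form n P x"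
    by (simp add: deflate_def sum_subtractf sum_divide_distrib power2_eq_square)
  then show ?thesis by (simp add: quad_form_eq_sum_squares[OF assms, symmetric])
qed

lemma quad_form_deflate:
  "quad_form n (deflate n P x) y =
     quad_form n P y - (\<Sum>k<n. mat_vec n P x k * y k)\<^sup>2 / quad_form n P x"
proof -
  let ?s = "\<Sum>k<n. mat_vec n P x k * y k"
  have "quad_form n (deflate n P x) y =
      (\<Sum>j<n. y j * mat_vec n P y j - ?s / quad_form n P x * (mat_vec n P x j * y j))"
    unfolding quad_form_def[of n "deflate n P x"] mat_vec_deflate
    by (intro sum.cong refl) (simp add: algebra_simps)
  also have "\<dots> = quad_form n P y - ?s / quad_form n P x * ?s"
    unfolding sum_subtractf sum_distrib_left[symmetric] quad_form_def[of n P y] ..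
  finally show ?thesis by (simp add: power2_eq_square)
qed

lemma mat_vec_deflate_kernel:
  assumes "is_proj n P" "\<And>k. k < n \<Longrightarrow> mat_vec n P y k = 0" "j < n"
  shows "mat_vec n (deflate n P x) y j = 0"
  using assms by (simp add: mat_vec_deflate mat_vec_adjoint[OF assms(1)])

lemma mat_vec_deflate_self:
  assumes "is_proj n P" "j < n"
  shows "mat_vec n (deflate n P x) x j = 0"
  using assms mat_vec_eq_0_if_quad_form_eq_0[OF assms(1) _ assms(2), of x]
  by (cases "quad_form n P x = 0")
     (auto simp: mat_vec_deflate mat_vec_adjoint[OF assms(1)] quad_form_def[symmetric])

lemma mat_vec_deflate_mat_vec:
  assumes "is_proj n P" "j < n"
  shows "mat_vec n (deflate n P x) (mat_vec n P x) j = 0"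
  using assms mat_vec_eq_0_if_quad_form_eq_0[OF assms(1) _ assms(2), of x]
  by (cases "quad_form n P x = 0")
     (auto simp: mat_vec_deflate mat_vec_idem quad_form_eq_sum_squares[OF assms(1)] power2_eq_square)

text \<open>By averaging. The index found serves as a pivot: it is the coordinate eliminated in
  \<open>quad_form_small_ball\<close> and the coordinate normalized to 1 in
  \<open>spread_normal_vector\<close>.\<close>

lemma exists_large_diagonal:
  fixes P :: "nat \<Rightarrow> nat \<Rightarrow> real"
  assumes "1 \<le> (\<Sum>j<n. P j j)"
  shows "\<exists>j<n. 1 / n \<le> P j j"
proof (rule ccontr)
  assume "\<not> ?thesis"
  then have *: "\<And>j. j < n \<Longrightarrow> P j j < 1 / n" by (auto simp: not_le)
  have "n \<noteq> 0" using assms by (auto intro!: Nat.gr0I)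
  then have "(\<Sum>j<n. P j j) < (\<Sum>j<n. 1 / n)"
    by (intro sum_strict_mono) (use * in auto)
  then show False using assms \<open>n \<noteq> 0\<close> by simp
qed

section \<open>Successive projections along the rows and Gram--Schmidt vectors\<close>

fun row_proj :: "nat \<Rightarrow> (nat \<Rightarrow> nat \<Rightarrow> real) \<Rightarrow> nat \<Rightarrow> nat \<Rightarrow> nat \<Rightarrow> real" where
  "row_proj n X 0 = (\<lambda>j k. if j = k then 1 else 0)"
| "row_proj n X (Suc i) = deflate n (row_proj n X i) (X i)"

definition row_dist2 :: "nat \<Rightarrow> (nat \<Rightarrow> nat \<Rightarrow> real) \<Rightarrow> nat \<Rightarrow> real" where
  "row_dist2 n X i = quad_form n (row_proj n X i) (X i)"

lemma row_proj_cong: "(\<And>l. l < i \<Longrightarrow> X l = Y l) \<Longrightarrow> row_proj n X i = row_proj n Y i"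
  by (induction i) auto

lemma is_proj_row_proj: "is_proj n (row_proj n X i)"
proof (induction i)
  case 0
  have "(\<Sum>l<n. (if j = l then 1 else 0) * (if l = k then 1 else 0)) = (if j = k then 1 else (0::real))"
    if "j < n" for j k
  proof -
    have "(\<Sum>l<n. (if j = l then 1 else 0) * (if l = k then 1 else 0)) =
        (\<Sum>l<n. if j = l then (if l = k then 1 else (0::real)) else 0)"
      by (intro sum.cong refl) simp
    also have "\<dots> = (if j = k then 1 else 0)" using that by (simp add: sum.delta')
    finally show ?thesis .
  qed
  then show ?case by (auto simp: is_proj_def)
qed (simp add: is_proj_deflate)

lemma trace_row_proj: "real n - real i \<le> (\<Sum>j<n. row_proj n X i j j)"
  by (induction i) (auto simp: trace_deflate[OF is_proj_row_proj])

lemma row_proj_kills_earlier_rows: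
  "l < i \<Longrightarrow> j < n \<Longrightarrow> mat_vec n (row_proj n X i) (X l) j = 0"
proof (induction i arbitrary: j)
  case (Suc i)
  then show ?case
    by (cases "l = i")
       (auto intro!: mat_vec_deflate_kernel mat_vec_deflate_self is_proj_row_proj)
qed simp

definition gs_row :: "nat \<Rightarrow> (nat \<Rightarrow> nat \<Rightarrow> real) \<Rightarrow> nat \<Rightarrow> nat \<Rightarrow> real" where
  "gs_row n X i = mat_vec n (row_proj n X i) (X i)"

lemma row_proj_kills_gs_row:
  "l < i \<Longrightarrow> j < n \<Longrightarrow> mat_vec n (row_proj n X i) (gs_row n X l) j = 0"
proof (induction i arbitrary: j)
  case (Suc i)
  then show ?case
    by (cases "l = i")
       (auto intro!: mat_vec_deflate_kernel mat_vec_deflate_mat_vec is_proj_row_proj simp: gs_row_def)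
qed simp

lemma gs_row_inner_self: "(\<Sum>j<n. gs_row n X i j * gs_row n X i j) = row_dist2 n X i"
  by (simp add: row_dist2_def quad_form_eq_sum_squares[OF is_proj_row_proj] gs_row_def power2_eq_square)

lemma gs_row_orthogonal_less:
  assumes "l < i" shows "(\<Sum>j<n. gs_row n X i j * gs_row n X l j) = 0"
  unfolding gs_row_def[of n X i] mat_vec_adjoint[OF is_proj_row_proj]
  by (simp add: row_proj_kills_gs_row assms)

lemma gs_row_orthogonal:
  assumes "l \<noteq> i" shows "(\<Sum>j<n. gs_row n X i j * gs_row n X l j) = 0"
  using gs_row_orthogonal_less[of l i n X] gs_row_orthogonal_less[of i l n X] assms
  by (cases "l < i") (auto simp: mult.commute)

text \<open>A formal unfolding of the rank-one subtractions. A vanishing \<open>row_dist2\<close>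
  contributes a zero summand on both sides, since division by zero yields 0; thus linear
  independence of the rows is never assumed.\<close>

lemma row_proj_expansion:
  "row_proj n X i j k = (if j = k then 1 else 0) - (\<Sum>l<i. gs_row n X l j * gs_row n X l k / row_dist2 n X l)"
  by (induction i) (auto simp: deflate_def gs_row_def row_dist2_def)

lemma row_gram_schmidt:
  assumes "j < n"
  shows "X i j = gs_row n X i j + (\<Sum>l<i. (\<Sum>k<n. gs_row n X l k * X i k) / row_dist2 n X l * gs_row n X l j)"
proof -
  have "gs_row n X i j = (\<Sum>k<n. (if j = k then X i k else 0)
          - (\<Sum>l<i. gs_row n X l j * gs_row n X l k / row_dist2 n X l * X i k))"
    unfolding gs_row_def[of n X i] mat_vec_def row_proj_expansion
    by (intro sum.cong refl) (simp add: left_diff_distrib sum_distrib_right)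
  also have "\<dots> = X i j - (\<Sum>k<n. \<Sum>l<i. gs_row n X l j * gs_row n X l k / row_dist2 n X l * X i k)"
    using assms by (simp add: sum_subtractf)
  also have "(\<Sum>k<n. \<Sum>l<i. gs_row n X l j * gs_row n X l k / row_dist2 n X l * X i k) =
      (\<Sum>l<i. \<Sum>k<n. gs_row n X l j * gs_row n X l k / row_dist2 n X l * X i k)"
    by (rule sum.swap)
  also have "\<dots> = (\<Sum>l<i. (\<Sum>k<n. gs_row n X l k * X i k) / row_dist2 n X l * gs_row n X l j)"
    by (intro sum.cong refl) (simp add: sum_distrib_left sum_distrib_right sum_divide_distrib algebra_simps)
  finally show ?thesis by simp
qed

text \<open>The matrix factors as \<open>C * G\<close> with the Gram--Schmidt coefficients in a unit
  lower triangular \<open>C\<close> and orthogonal rows in \<open>G\<close>, so the Gram matrix of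
  \<open>G\<close> is diagonal. Squaring removes the sign, and singular matrices are
  covered.\<close>

lemma det_square_eq_prod_row_dist2:
  "(Determinant.det (mat n n (\<lambda>(i, j). X i j)))\<^sup>2 = (\<Prod>i<n. row_dist2 n X i)"
proof -
  define c where "c i l = (\<Sum>k<n. gs_row n X l k * X i k) / row_dist2 n X l" for i l
  define C where "C = mat n n (\<lambda>(i, l). if l < i then c i l else if l = i then 1 else 0)"
  define G where "G = mat n n (\<lambda>(i, j). gs_row n X i j)"
  have [simp]: "C \<in> carrier_mat n n" "G \<in> carrier_mat n n" "transpose_mat G \<in> carrier_mat n n"
    by (auto simp: C_def G_def)
  have "mat n n (\<lambda>(i, j). X i j) = C * G"
  proof (rule eq_matI)
    fix i j assume "i < dim_row (C * G)" "j < dim_col (C * G)"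
    then have ij: "i < n" "j < n" by (auto simp: C_def G_def)
    have "(C * G) $$ (i, j) = (\<Sum>l<n. (if l < i then c i l else if l = i then 1 else 0) * gs_row n X l j)"
      using ij by (simp add: C_def G_def scalar_prod_def lessThan_atLeast0)
    also have "\<dots> = (\<Sum>l<n. (if l = i then gs_row n X l j else 0) + (if l < i then c i l * gs_row n X l j else 0))"
      by (intro sum.cong refl) auto
    also have "\<dots> = gs_row n X i j + (\<Sum>l<n. if l < i then c i l * gs_row n X l j else 0)"
      using ij by (simp add: sum.distrib)
    also have "(\<Sum>l<n. if l < i then c i l * gs_row n X l j else 0) = (\<Sum>l<i. c i l * gs_row n X l j)"
      using ij by (intro sum.mono_neutral_cong_right) auto
    also have "gs_row n X i j + (\<Sum>l<i. c i l * gs_row n X l j) = X i j"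
      unfolding c_def using row_gram_schmidt[OF ij(2), of X i] by simp
    finally show "mat n n (\<lambda>(i, j). X i j) $$ (i, j) = (C * G) $$ (i, j)" using ij by simp
  qed (auto simp: C_def G_def)
  moreover have "Determinant.det C = 1"
  proof -
    have "Determinant.det C = prod_list (diag_mat C)"
      by (rule det_lower_triangular[of n]) (auto simp: C_def)
    also have "diag_mat C = replicate n 1"
      by (auto simp: diag_mat_def C_def intro!: nth_equalityI)
    finally show ?thesis by simp
  qed
  ultimately have 1: "Determinant.det (mat n n (\<lambda>(i, j). X i j)) = Determinant.det G"
    by (simp add: det_mult[of _ n])
  have D: "G * transpose_mat G = mat n n (\<lambda>(i, l). if i = l then row_dist2 n X i else 0)"
  proof (rule eq_matI)
    fix i l assume "i < dim_row (mat n n (\<lambda>(i, l). if i = l then row_dist2 n X i else 0))"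
      "l < dim_col (mat n n (\<lambda>(i, l). if i = l then row_dist2 n X i else 0))"
    then have il: "i < n" "l < n" by auto
    have "(G * transpose_mat G) $$ (i, l) = (\<Sum>j<n. gs_row n X i j * gs_row n X l j)"
      using il by (simp add: G_def scalar_prod_def lessThan_atLeast0)
    then show "(G * transpose_mat G) $$ (i, l) = mat n n (\<lambda>(i, l). if i = l then row_dist2 n X i else 0) $$ (i, l)"
      using il gs_row_orthogonal[of l i n X] by (auto simp: gs_row_inner_self)
  qed (auto simp: G_def)
  have "(Determinant.det G)\<^sup>2 = Determinant.det (G * transpose_mat G)"
    by (simp add: det_mult[of _ n] det_transpose[of _ n] power2_eq_square)
  also have "\<dots> = prod_list (diag_mat (mat n n (\<lambda>(i, l). if i = l then row_dist2 n X i else 0)))"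
    unfolding D by (rule det_lower_triangular[of n]) auto
  also have "\<dots> = prod_list (map (row_dist2 n X) [0..<n])"
    by (intro arg_cong[where f=prod_list] nth_equalityI) (auto simp: diag_mat_def)
  also have "\<dots> = (\<Prod>i<n. row_dist2 n X i)"
    by (simp add: prod.distinct_set_conv_list[symmetric] lessThan_atLeast0)
  finally show ?thesis by (simp add: 1)
qed

section \<open>Conditioning in product measures\<close>

text \<open>Fubini with the new coordinate outermost: for each of its values the remaining
  coordinates give an honest probability, which is what the induction hypothesis of the
  Littlewood--Offord estimate bounds.\<close>

lemma measure_PiM_insert:
  fixes M :: "'i \<Rightarrow> 'b measure"
  assumes M: "\<And>i. prob_space (M i)" and I: "finite I" "i \<notin> I"
    and A[measurable]: "A \<in> sets (PiM (insert i I) M)"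
  shows "integrable (M i) (\<lambda>y. measure (PiM I M) {x \<in> space (PiM I M). x(i := y) \<in> A})"
    and "measure (PiM (insert i I) M) A =
      (\<integral>y. measure (PiM I M) {x \<in> space (PiM I M). x(i := y) \<in> A} \<partial>M i)"
proof -
  interpret product_sigma_finite M
    unfolding product_sigma_finite_def using M by (auto intro: prob_space_imp_sigma_finite)
  interpret Mi: prob_space "M i" by (rule M)
  interpret PI: prob_space "PiM I M" by (intro prob_space_PiM M)
  interpret PII: prob_space "PiM (insert i I) M" by (intro prob_space_PiM M)
  let ?\<psi> = "\<lambda>y. measure (PiM I M) {x \<in> space (PiM I M). x(i := y) \<in> A}"
  have [measurable]: "(\<lambda>(x, y). x(i := y)) \<in> PiM I M \<Otimes>\<^sub>M M i \<rightarrow>\<^sub>M PiM (insert i I) M"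
    by (rule measurable_add_dim)
  have [measurable]: "(\<lambda>x. x(i := y)) \<in> PiM I M \<rightarrow>\<^sub>M PiM (insert i I) M" if "y \<in> space (M i)" for y
    using measurable_compose[OF measurable_Pair2'[OF that] \<open>(\<lambda>(x, y). x(i := y)) \<in> _\<close>]
    by simp
  have eq: "(\<integral>\<^sup>+x. indicator A (x(i := y)) \<partial>PiM I M) = ennreal (?\<psi> y)" if "y \<in> space (M i)" for y
  proof -
    have "(\<integral>\<^sup>+x. indicator A (x(i := y)) \<partial>PiM I M) =
        (\<integral>\<^sup>+x. indicator {x \<in> space (PiM I M). x(i := y) \<in> A} x \<partial>PiM I M)"
      by (intro nn_integral_cong) (simp add: indicator_def)
    also have "\<dots> = emeasure (PiM I M) {x \<in> space (PiM I M). x(i := y) \<in> A}"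
      using that by (intro nn_integral_indicator) measurable
    finally show ?thesis by (simp add: PI.emeasure_eq_measure)
  qed
  have "(\<lambda>y. enn2real (\<integral>\<^sup>+x. indicator A (x(i := y)) \<partial>PiM I M)) \<in> borel_measurable (M i)"
    by measurable
  then have m: "?\<psi> \<in> borel_measurable (M i)"
    by (subst measurable_cong[where g="\<lambda>y. enn2real (\<integral>\<^sup>+x. indicator A (x(i := y)) \<partial>PiM I M)"])
       (auto simp: eq)
  show int: "integrable (M i) ?\<psi>"
    by (rule Mi.integrable_const_bound[of _ 1]) (auto simp: m)
  have "emeasure (PiM (insert i I) M) A = (\<integral>\<^sup>+y. \<integral>\<^sup>+x. indicator A (x(i := y)) \<partial>PiM I M \<partial>M i)"
    by (subst product_nn_integral_insert_rev[symmetric]) (use I in auto)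
  also have "\<dots> = (\<integral>\<^sup>+y. ennreal (?\<psi> y) \<partial>M i)"
    by (intro nn_integral_cong eq)
  also have "\<dots> = ennreal (\<integral>y. ?\<psi> y \<partial>M i)"
    by (intro nn_integral_eq_integral int) auto
  finally show "measure (PiM (insert i I) M) A = (\<integral>y. ?\<psi> y \<partial>M i)"
    by (simp add: PII.emeasure_eq_measure)
qed

text \<open>The invariance hypothesis says that \<open>B\<close> is determined by the coordinates
  other than \<open>i\<close>; on \<open>B\<close>, resampling coordinate \<open>i\<close> hits
  \<open>A\<close> with probability at most \<open>c\<close>. Applied along a nested chain of events
  this produces powers such as (1 - c)^d.\<close>

lemma measure_PiM_le_conditional:
  fixes M :: "'i \<Rightarrow> 'b measure"
  assumes M: "\<And>i. prob_space (M i)" and I: "finite I" "i \<in> I"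
    and A[measurable]: "A \<in> sets (PiM I M)" and B[measurable]: "B \<in> sets (PiM I M)"
    and AB: "A \<subseteq> B"
    and inv: "\<And>x y. x \<in> space (PiM I M) \<Longrightarrow> y \<in> space (M i) \<Longrightarrow> x(i := y) \<in> B \<longleftrightarrow> x \<in> B"
    and c: "\<And>x. x \<in> B \<Longrightarrow> measure (M i) {y \<in> space (M i). x(i := y) \<in> A} \<le> c"
    and "0 \<le> c"
  shows "measure (PiM I M) A \<le> c * measure (PiM I M) B"
proof -
  interpret product_sigma_finite M
    unfolding product_sigma_finite_def using M by (auto intro: prob_space_imp_sigma_finite)
  define J where "J = I - {i}"
  have J: "finite J" "i \<notin> J" "insert i J = I" using I by (auto simp: J_def)
  interpret Mi: prob_space "M i" by (rule M)
  interpret PI: prob_space "PiM I M" by (intro prob_space_PiM M)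
  have "emeasure (PiM I M) A = (\<integral>\<^sup>+x. (\<integral>\<^sup>+y. indicator A (x(i := y)) \<partial>M i) \<partial>PiM J M)"
    by (subst product_nn_integral_insert[symmetric]) (use J in auto)
  also have "\<dots> \<le> (\<integral>\<^sup>+x. (\<integral>\<^sup>+y. ennreal c * indicator B (x(i := y)) \<partial>M i) \<partial>PiM J M)"
  proof (rule nn_integral_mono)
    fix x assume x: "x \<in> space (PiM J M)"
    \<comment> \<open>An arbitrary filler for the missing coordinate; membership in \<open>B\<close>
      does not depend on it.\<close>
    obtain y0 where y0: "y0 \<in> space (M i)" using Mi.not_empty by auto
    have xI: "x(i := y) \<in> space (PiM I M)" if "y \<in> space (M i)" for y
      using measurable_space[OF measurable_component_update[OF x J(2)] that] J(3) by simp
    have xB: "x(i := y) \<in> B \<longleftrightarrow> x(i := y0) \<in> B" if "y \<in> space (M i)" for y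
      using inv[OF xI[OF y0] that] by simp
    have [measurable]: "(\<lambda>y. x(i := y)) \<in> M i \<rightarrow>\<^sub>M PiM I M"
      using measurable_component_update[OF x J(2)] J(3) by simp
    show "(\<integral>\<^sup>+y. indicator A (x(i := y)) \<partial>M i) \<le> (\<integral>\<^sup>+y. ennreal c * indicator B (x(i := y)) \<partial>M i)"
    proof (cases "x(i := y0) \<in> B")
      case True
      have "(\<integral>\<^sup>+y. indicator A (x(i := y)) \<partial>M i) =
          (\<integral>\<^sup>+y. indicator {y \<in> space (M i). (x(i := y0))(i := y) \<in> A} y \<partial>M i)"
        by (intro nn_integral_cong) (simp add: indicator_def)
      also have "\<dots> = emeasure (M i) {y \<in> space (M i). (x(i := y0))(i := y) \<in> A}"
        by (intro nn_integral_indicator) simp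
      also have "\<dots> \<le> ennreal c"
        using c[OF True] \<open>0 \<le> c\<close> by (simp add: Mi.emeasure_eq_measure)
      also have "\<dots> = (\<integral>\<^sup>+y. ennreal c \<partial>M i)" by (simp add: Mi.emeasure_space_1)
      also have "\<dots> = (\<integral>\<^sup>+y. ennreal c * indicator B (x(i := y)) \<partial>M i)"
        using xB True by (intro nn_integral_cong) simp
      finally show ?thesis .
    next
      case False
      then have "(\<integral>\<^sup>+y. indicator A (x(i := y)) \<partial>M i) = (\<integral>\<^sup>+y. 0 \<partial>M i)"
        using xB AB by (intro nn_integral_cong) (auto simp: indicator_def)
      then show ?thesis by simp
    qed
  qed
  also have "\<dots> = (\<integral>\<^sup>+x. ennreal c * indicator B x \<partial>PiM I M)"
    unfolding J(3)[symmetric]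
    by (subst product_nn_integral_insert[symmetric]) (use J B in auto)
  also have "\<dots> = ennreal c * emeasure (PiM I M) B"
    by (simp add: nn_integral_cmult)
  finally show ?thesis
    using \<open>0 \<le> c\<close> by (simp add: PI.emeasure_eq_measure ennreal_mult[symmetric])
qed

section \<open>Quadratic forms in independent coordinates\<close>

text \<open>All estimates depend on the entries only through their common law, so they are proved on
  product spaces over \<open>\<mu>\<close>; random variables on the given spaces return only in
  \<open>distr_matrix_eq_PiM\<close>.\<close>

locale entry_law = prob_space \<mu> for \<mu> :: "real measure" +
  assumes sets_law[simp, measurable_cong]: "sets \<mu> = sets borel"
    and law_mean: "(\<integral>y. y \<partial>\<mu>) = 0"
    and law_second: "(\<integral>y. y\<^sup>2 \<partial>\<mu>) = 1"
    and law_fourth: "integrable \<mu> (\<lambda>y. y ^ 4)"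
begin

section \<open>Moments of the law and anticoncentration of one entry\<close>

definition "K = (\<integral>y. y ^ 4 \<partial>\<mu>)"
definition "c = 1 / (16 * K)"

lemma space_law[simp]: "space \<mu> = UNIV"
  using sets_eq_imp_space_eq[OF sets_law] by simp

lemma prob_UNIV[simp]: "prob UNIV = 1"
  using prob_space by simp

lemma integrable_power: "k \<le> 4 \<Longrightarrow> integrable \<mu> (\<lambda>y. y ^ k)"
proof (rule Bochner_Integration.integrable_bound[where f="\<lambda>y. 1 + y ^ 4"])
  assume k: "k \<le> 4"
  have "\<bar>y\<bar> ^ k \<le> 1 + y ^ 4" for y :: real
  proof (cases "\<bar>y\<bar> \<le> 1")
    case True
    then have "\<bar>y\<bar> ^ k \<le> 1" by (simp add: power_le_one)
    then show ?thesis by (smt (verit) zero_le_even_power even_numeral)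
  next
    case False
    then have "\<bar>y\<bar> ^ k \<le> \<bar>y\<bar> ^ 4" using k by (intro power_increasing) auto
    then show ?thesis by (simp add: power_even_abs)
  qed
  then show "AE y in \<mu>. norm (y ^ k) \<le> norm (1 + y ^ 4)"
    by (auto simp: power_abs intro!: AE_I2 order_trans[OF _ abs_ge_self])
qed (auto simp: law_fourth)

lemma integrable_1[simp]: "integrable \<mu> (\<lambda>y. y)"
  and integrable_2[simp]: "integrable \<mu> (\<lambda>y. y\<^sup>2)"
  and integrable_3[simp]: "integrable \<mu> (\<lambda>y. y ^ 3)"
  and integrable_4[simp]: "integrable \<mu> (\<lambda>y. y ^ 4)"
  using integrable_power[of 1] integrable_power[of 2] integrable_power[of 3] law_fourth by auto

text \<open>A normal form for all moment computations: later integrands are padded with zero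
  coefficients so that this one rule applies.\<close>

lemma integral_quartic:
  "integrable \<mu> (\<lambda>y. a0 + a1 * y + a2 * y\<^sup>2 + a3 * y ^ 3 + a4 * y ^ 4)"
  "(\<integral>y. a0 + a1 * y + a2 * y\<^sup>2 + a3 * y ^ 3 + a4 * y ^ 4 \<partial>\<mu>) =
     a0 + a2 + a3 * (\<integral>y. y ^ 3 \<partial>\<mu>) + a4 * K"
  by (simp_all add: law_mean law_second K_def)

lemma K_ge_1: "1 \<le> K"
proof -
  have "0 \<le> (\<integral>y. (y\<^sup>2 - 1)\<^sup>2 \<partial>\<mu>)" by simp
  also have "(\<lambda>y::real. (y\<^sup>2 - 1)\<^sup>2) = (\<lambda>y. 1 + 0 * y + (-2) * y\<^sup>2 + 0 * y ^ 3 + 1 * y ^ 4)"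
    by (auto simp: power2_eq_square power4_eq_xxxx algebra_simps)
  finally show ?thesis unfolding integral_quartic(2) by simp
qed

text \<open>Cauchy--Schwarz for y and y^2, read off from the nonnegativity of the mean of (y^2 - t
  y)^2 = K - t^2 in the mean, with t the third moment.\<close>

lemma third_moment_square: "(\<integral>y. y ^ 3 \<partial>\<mu>)\<^sup>2 \<le> K"
proof -
  let ?t = "\<integral>y. y ^ 3 \<partial>\<mu>"
  have "0 \<le> (\<integral>y. (y\<^sup>2 - ?t * y)\<^sup>2 \<partial>\<mu>)" by simp
  also have "(\<lambda>y::real. (y\<^sup>2 - ?t * y)\<^sup>2) = (\<lambda>y. 0 + 0 * y + ?t\<^sup>2 * y\<^sup>2 + (-2 * ?t) * y ^ 3 + 1 * y ^ 4)"
    by (auto simp: power2_eq_square power4_eq_xxxx power3_eq_cube algebra_simps)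
  finally show ?thesis unfolding integral_quartic(2) by (simp add: power2_eq_square)
qed

lemma c_bounds: "0 < c" "c \<le> 1"
  using K_ge_1 by (auto simp: c_def)

text \<open>An argument in the style of Paley--Zygmund. The mean of (y - x)^2 is 1 + x^2, of which
  the points within 1/2 of x supply at most 1/4; the fourth moment prevents the remainder from being
  carried by a very small set. The bound is uniform in \<open>x\<close>, as conditioning on the
  other coordinates shifts \<open>x\<close> arbitrarily.\<close>

lemma far_probability: "c \<le> measure \<mu> {y. 1 / 2 < \<bar>y - x\<bar>}"
proof (rule ccontr)
  define F where "F = {y. 1 / 2 < \<bar>y - x\<bar>}"
  define p where "p = measure \<mu> F"
  \<comment> \<open>The weight in (y - x)^2 <= (y - x)^4 / (2 l) + l / 2. With this choice the
    fourth-moment part is at most (1 + x^2) / 2, and \<open>p < c\<close> puts the other part below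
    (1 + x^2) / 4; together with 1/4 this falls short of 1 + x^2.\<close>
  define l where "l = 8 * K * (1 + x\<^sup>2)"
  assume "\<not> c \<le> measure \<mu> {y. 1 / 2 < \<bar>y - x\<bar>}"
  then have p: "p < c" by (simp add: p_def F_def)
  have l: "0 < l" unfolding l_def using K_ge_1 by (intro mult_pos_pos add_pos_nonneg) auto
  have [measurable, simp]: "F \<in> sets borel" by (simp add: F_def)
  have [simp]: "integrable \<mu> (indicat_real F)"
    by (rule integrable_real_indicator) (auto simp: less_top[symmetric])
  have pw: "(y - x)\<^sup>2 \<le> 1 / 4 + 4 / l * (y ^ 4 + x ^ 4) + l / 2 * indicator F y" for y
  proof -
    have a: "(y - x) ^ 4 \<le> 8 * (y ^ 4 + x ^ 4)"
    proof -
      have 1: "(y - x)\<^sup>2 \<le> 2 * (y\<^sup>2 + x\<^sup>2)"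
        using zero_le_power2[of "y + x"] by (simp add: power2_eq_square algebra_simps)
      have 2: "(y\<^sup>2 + x\<^sup>2)\<^sup>2 \<le> 2 * (y ^ 4 + x ^ 4)"
        using zero_le_power2[of "y\<^sup>2 - x\<^sup>2"] by (simp add: power2_eq_square power4_eq_xxxx algebra_simps)
      have "(y - x) ^ 4 = ((y - x)\<^sup>2)\<^sup>2" by simp
      also have "\<dots> \<le> (2 * (y\<^sup>2 + x\<^sup>2))\<^sup>2" by (intro power_mono 1) simp
      also have "\<dots> \<le> 8 * (y ^ 4 + x ^ 4)" using 2 unfolding power_mult_distrib by simp
      finally show ?thesis .
    qed
    have b: "(y - x)\<^sup>2 \<le> (y - x) ^ 4 / (2 * l) + l / 2"
    proof -
      have "0 \<le> ((y - x)\<^sup>2 - l)\<^sup>2 / (2 * l)" using l by simp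
      also have "\<dots> = (y - x) ^ 4 / (2 * l) + l / 2 - (y - x)\<^sup>2"
        using l by (simp add: power2_eq_square power4_eq_xxxx field_simps)
      finally show ?thesis by simp
    qed
    have d: "(y - x) ^ 4 / (2 * l) \<le> 4 / l * (y ^ 4 + x ^ 4)"
      using a l by (simp add: field_simps)
    have e: "0 \<le> 4 / l * (y ^ 4 + x ^ 4)" using l by simp
    show ?thesis
    proof (cases "y \<in> F")
      case True then show ?thesis using b d by simp
    next
      case False
      then have "\<bar>y - x\<bar>\<^sup>2 \<le> (1 / 2)\<^sup>2" by (intro power_mono) (auto simp: F_def)
      then show ?thesis using e False by (simp add: power2_eq_square)
    qed
  qed
  have "(\<integral>y. (y - x)\<^sup>2 \<partial>\<mu>) \<le> (\<integral>y. 1 / 4 + 4 / l * (y ^ 4 + x ^ 4) + l / 2 * indicator F y \<partial>\<mu>)"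
  proof (rule integral_mono)
    have "(\<lambda>y. (y - x)\<^sup>2) = (\<lambda>y. x\<^sup>2 + (-2 * x) * y + 1 * y\<^sup>2 + 0 * y ^ 3 + 0 * y ^ 4)"
      by (auto simp: power2_eq_square algebra_simps)
    then show "integrable \<mu> (\<lambda>y. (y - x)\<^sup>2)" by (simp only: integral_quartic(1))
  qed (use pw in auto)
  also have "\<dots> = 1 / 4 + 4 / l * (K + x ^ 4) + l / 2 * p"
    by (simp add: K_def p_def)
  also have "(\<integral>y. (y - x)\<^sup>2 \<partial>\<mu>) = 1 + x\<^sup>2"
  proof -
    have e: "(\<lambda>y. (y - x)\<^sup>2) = (\<lambda>y. x\<^sup>2 + (-2 * x) * y + 1 * y\<^sup>2 + 0 * y ^ 3 + 0 * y ^ 4)"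
      by (auto simp: power2_eq_square algebra_simps)
    show ?thesis unfolding e integral_quartic(2) by simp
  qed
  finally have 1: "1 + x\<^sup>2 \<le> 1 / 4 + 4 / l * (K + x ^ 4) + l / 2 * p" .
  have "K + x ^ 4 \<le> K * (1 + x\<^sup>2)\<^sup>2"
  proof -
    have "x ^ 4 \<le> K * x ^ 4" using mult_right_mono[OF K_ge_1, of "x ^ 4"] by simp
    moreover have "K * (1 + x\<^sup>2)\<^sup>2 = K + K * x ^ 4 + 2 * K * x\<^sup>2"
      by (simp add: power2_eq_square power4_eq_xxxx algebra_simps)
    moreover have "0 \<le> 2 * K * x\<^sup>2" using K_ge_1 by simp
    ultimately show ?thesis by linarith
  qed
  then have "4 / l * (K + x ^ 4) \<le> 4 / l * (K * (1 + x\<^sup>2)\<^sup>2)"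
    using l by (intro mult_left_mono) auto
  also have "\<dots> = (1 + x\<^sup>2) / 2"
    using K_ge_1 l unfolding l_def by (simp add: power2_eq_square field_simps)
  finally have 2: "4 / l * (K + x ^ 4) \<le> (1 + x\<^sup>2) / 2" .
  have "l / 2 * p < l / 2 * c" using p l by simp
  also have "\<dots> = (1 + x\<^sup>2) / 4" using K_ge_1 by (simp add: l_def c_def)
  finally have "1 + x\<^sup>2 < 1 / 4 + (1 + x\<^sup>2) / 2 + (1 + x\<^sup>2) / 4" using 1 2 by linarith
  moreover have "0 \<le> x\<^sup>2" by simp
  ultimately show False by (simp add: field_simps)
qed

lemma small_ball: "measure \<mu> {y. \<bar>y - x\<bar> \<le> 1 / 2} \<le> 1 - c"
proof -
  have "{y. \<bar>y - x\<bar> \<le> 1 / 2} = space \<mu> - {y. 1 / 2 < \<bar>y - x\<bar>}" by auto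
  moreover have "prob (space \<mu> - {y. 1 / 2 < \<bar>y - x\<bar>}) = 1 - prob {y. 1 / 2 < \<bar>y - x\<bar>}"
    by (rule prob_compl) simp
  ultimately show ?thesis using far_probability[of x] by simp
qed

abbreviation "coords I \<equiv> PiM I (\<lambda>_::nat. \<mu>)"

sublocale coords: product_sigma_finite "\<lambda>_::nat. \<mu>"
  by (simp add: product_sigma_finite_def prob_space_imp_sigma_finite prob_space_axioms)

lemma prob_space_coords: "prob_space (coords I)"
  by (intro prob_space_PiM prob_space_axioms)

text \<open>Centred independent coordinates are orthogonal. Nonnegative integrals spare all
  integrability obligations on the product space.\<close>

lemma linear_form_second_moment:
  assumes "finite I"
  shows "(\<integral>\<^sup>+x. ennreal ((\<Sum>j\<in>I. a j * x j)\<^sup>2) \<partial>coords I) = ennreal (\<Sum>j\<in>I. (a j)\<^sup>2)"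
  using assms
proof (induction I)
  case empty
  show ?case by (simp)
next
  case (insert i I)
  have "(\<integral>\<^sup>+x. ennreal ((\<Sum>j\<in>insert i I. a j * x j)\<^sup>2) \<partial>coords (insert i I)) =
      (\<integral>\<^sup>+x. \<integral>\<^sup>+y. ennreal ((\<Sum>j\<in>insert i I. a j * (x(i := y)) j)\<^sup>2) \<partial>\<mu> \<partial>coords I)"
    using insert.hyps by (subst coords.product_nn_integral_insert) auto
  also have "\<dots> = (\<integral>\<^sup>+x. ennreal ((a i)\<^sup>2) + ennreal ((\<Sum>j\<in>I. a j * x j)\<^sup>2) \<partial>coords I)"
  proof (intro nn_integral_cong)
    fix x :: "nat \<Rightarrow> real"
    let ?L = "\<Sum>j\<in>I. a j * x j"
    have L: "(\<Sum>j\<in>insert i I. a j * (x(i := y)) j) = a i * y + ?L" for y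
      using insert.hyps by (simp) (intro sum.cong, auto)
    have e: "(\<lambda>y. (a i * y + ?L)\<^sup>2) = (\<lambda>y. ?L\<^sup>2 + (2 * a i * ?L) * y + (a i)\<^sup>2 * y\<^sup>2 + 0 * y ^ 3 + 0 * y ^ 4)"
      by (auto simp: power2_eq_square algebra_simps)
    have "(\<integral>\<^sup>+y. ennreal ((a i * y + ?L)\<^sup>2) \<partial>\<mu>) = ennreal (\<integral>y. (a i * y + ?L)\<^sup>2 \<partial>\<mu>)"
      by (intro nn_integral_eq_integral) (auto simp only: e integral_quartic(1), auto)
    also have "(\<integral>y. (a i * y + ?L)\<^sup>2 \<partial>\<mu>) = (a i)\<^sup>2 + ?L\<^sup>2"
      unfolding e integral_quartic(2) by simp
    finally show "(\<integral>\<^sup>+y. ennreal ((\<Sum>j\<in>insert i I. a j * (x(i := y)) j)\<^sup>2) \<partial>\<mu>) =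
        ennreal ((a i)\<^sup>2) + ennreal (?L\<^sup>2)"
      unfolding L by simp
  qed
  also have "\<dots> = ennreal ((a i)\<^sup>2) + (\<integral>\<^sup>+x. ennreal ((\<Sum>j\<in>I. a j * x j)\<^sup>2) \<partial>coords I)"
    by (subst nn_integral_add) (auto simp: prob_space.emeasure_space_1[OF prob_space_coords])
  also have "\<dots> = ennreal ((a i)\<^sup>2 + (\<Sum>j\<in>I. (a j)\<^sup>2))"
    unfolding insert.IH by (simp add: sum_nonneg)
  finally show ?case using insert.hyps by simp
qed

end

lemma sum_insert_square_sym:
  fixes f :: "'a \<Rightarrow> 'a \<Rightarrow> real"
  assumes "finite I" "i \<notin> I" "\<And>j. j \<in> I \<Longrightarrow> f j i = f i j"
  shows "(\<Sum>j\<in>insert i I. \<Sum>k\<in>insert i I. f j k) = (\<Sum>j\<in>I. \<Sum>k\<in>I. f j k) + 2 * (\<Sum>k\<in>I. f i k) + f i i"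
proof -
  have "(\<Sum>j\<in>I. \<Sum>k\<in>insert i I. f j k) = (\<Sum>j\<in>I. f i j + (\<Sum>k\<in>I. f j k))"
    using assms by (intro sum.cong refl) simp
  then show ?thesis using assms by (simp add: sum.distrib)
qed

lemma measurable_mat_vec:
  assumes [measurable]: "\<And>j k. j < n \<Longrightarrow> k < n \<Longrightarrow> (\<lambda>\<omega>. P \<omega> j k) \<in> borel_measurable M"
    "\<And>k. k < n \<Longrightarrow> (\<lambda>\<omega>. x \<omega> k) \<in> borel_measurable M" and j: "j < n"
  shows "(\<lambda>\<omega>. mat_vec n (P \<omega>) (x \<omega>) j) \<in> borel_measurable M"
  using j unfolding mat_vec_def by (intro borel_measurable_sum borel_measurable_times) auto

lemma measurable_quad_form:
  assumes [measurable]: "\<And>j k. j < n \<Longrightarrow> k < n \<Longrightarrow> (\<lambda>\<omega>. P \<omega> j k) \<in> borel_measurable M"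
    "\<And>k. k < n \<Longrightarrow> (\<lambda>\<omega>. x \<omega> k) \<in> borel_measurable M"
  shows "(\<lambda>\<omega>. quad_form n (P \<omega>) (x \<omega>)) \<in> borel_measurable M"
  unfolding quad_form_def by (intro borel_measurable_sum borel_measurable_times measurable_mat_vec) auto

section \<open>Concentration and small-ball bounds for quadratic forms\<close>

context entry_law
begin

lemma measurable_quad_form_coords[measurable]: "quad_form n P \<in> borel_measurable (coords {..<n})"
  by (rule measurable_quad_form[where P="\<lambda>_. P" and x="\<lambda>x. x"]) auto

text \<open>A new coordinate y changes the centred form by 2 y L + a (y^2 - 1), which has mean zero
  given the others. Squaring therefore leaves only second moments and a term 4 L a m with the third
  moment m. Splitting that term by AM-GM turns 4 L^2 into 6 L^2 and a^2 K into 3 K a^2, whence the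
  factor \<open>3 * K\<close>.\<close>

lemma quadratic_form_variance:
  assumes "finite I" "\<And>j k. j \<in> I \<Longrightarrow> k \<in> I \<Longrightarrow> p j k = p k j"
  shows "(\<integral>\<^sup>+x. ennreal (((\<Sum>j\<in>I. \<Sum>k\<in>I. p j k * x j * x k) - (\<Sum>j\<in>I. p j j))\<^sup>2) \<partial>coords I)
     \<le> ennreal (3 * K * (\<Sum>j\<in>I. \<Sum>k\<in>I. (p j k)\<^sup>2))"
  using assms
proof (induction I)
  case empty
  show ?case by simp
next
  case (insert i I)
  let ?q = "\<lambda>x. (\<Sum>j\<in>I. \<Sum>k\<in>I. p j k * x j * x k) - (\<Sum>j\<in>I. p j j)"
  let ?L = "\<lambda>x. \<Sum>k\<in>I. p i k * x k"
  let ?S = "\<Sum>j\<in>I. \<Sum>k\<in>I. (p j k)\<^sup>2" and ?R = "\<Sum>k\<in>I. (p i k)\<^sup>2"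
  let ?q' = "\<lambda>x. (\<Sum>j\<in>insert i I. \<Sum>k\<in>insert i I. p j k * x j * x k) - (\<Sum>j\<in>insert i I. p j j)"
  let ?m = "\<integral>y. y ^ 3 \<partial>\<mu>"
  have sym: "p j i = p i j" if "j \<in> I" for j using insert.prems that by auto
  have q': "?q' (x(i := y)) = ?q x + 2 * y * ?L x + p i i * (y\<^sup>2 - 1)" for x y
  proof -
    have "(\<Sum>j\<in>insert i I. \<Sum>k\<in>insert i I. p j k * (x(i := y)) j * (x(i := y)) k) =
        (\<Sum>j\<in>I. \<Sum>k\<in>I. p j k * (x(i := y)) j * (x(i := y)) k)
          + 2 * (\<Sum>k\<in>I. p i k * (x(i := y)) i * (x(i := y)) k) + p i i * (x(i := y)) i * (x(i := y)) i"
      using insert.hyps sym by (intro sum_insert_square_sym) auto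
    also have "(\<Sum>j\<in>I. \<Sum>k\<in>I. p j k * (x(i := y)) j * (x(i := y)) k) = (\<Sum>j\<in>I. \<Sum>k\<in>I. p j k * x j * x k)"
      using insert.hyps by (intro sum.cong refl) auto
    also have "(\<Sum>k\<in>I. p i k * (x(i := y)) i * (x(i := y)) k) = y * ?L x"
      unfolding sum_distrib_left using insert.hyps by (intro sum.cong refl) auto
    finally show ?thesis
      using insert.hyps by (simp add: power2_eq_square algebra_simps)
  qed
  have inner: "(\<integral>\<^sup>+y. ennreal ((?q' (x(i := y)))\<^sup>2) \<partial>\<mu>)
      \<le> ennreal ((?q x)\<^sup>2) + (ennreal 6 * ennreal ((?L x)\<^sup>2) + ennreal (3 * K * (p i i)\<^sup>2))" for x
  proof -
    define q L a where "q = ?q x" and "L = ?L x" and "a = p i i"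
    have e: "(\<lambda>y. (q + 2 * y * L + a * (y\<^sup>2 - 1))\<^sup>2) = (\<lambda>y. (q - a)\<^sup>2 + (4 * L * (q - a)) * y
       + (4 * L\<^sup>2 + 2 * a * (q - a)) * y\<^sup>2 + (4 * L * a) * y ^ 3 + a\<^sup>2 * y ^ 4)"
      by (auto simp: power2_eq_square power3_eq_cube power4_eq_xxxx algebra_simps)
    have "(\<integral>\<^sup>+y. ennreal ((q + 2 * y * L + a * (y\<^sup>2 - 1))\<^sup>2) \<partial>\<mu>) =
        ennreal (\<integral>y. (q + 2 * y * L + a * (y\<^sup>2 - 1))\<^sup>2 \<partial>\<mu>)"
      by (intro nn_integral_eq_integral) (auto simp only: e integral_quartic(1), auto)
    also have "(\<integral>y. (q + 2 * y * L + a * (y\<^sup>2 - 1))\<^sup>2 \<partial>\<mu>) = q\<^sup>2 + 4 * L\<^sup>2 + a\<^sup>2 * (K - 1) + 4 * L * a * ?m"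
      unfolding e integral_quartic(2) by (simp add: power2_eq_square algebra_simps)
    also have "\<dots> \<le> q\<^sup>2 + (6 * L\<^sup>2 + 3 * K * a\<^sup>2)"
    proof -
      have "0 \<le> 2 * (L - a * ?m)\<^sup>2" by simp
      then have 1: "4 * L * a * ?m \<le> 2 * L\<^sup>2 + 2 * (a\<^sup>2 * ?m\<^sup>2)"
        by (simp add: power2_eq_square algebra_simps)
      have 2: "a\<^sup>2 * ?m\<^sup>2 \<le> a\<^sup>2 * K" by (intro mult_left_mono third_moment_square) simp
      have 3: "a\<^sup>2 * (K - 1) \<le> a\<^sup>2 * K" by (intro mult_left_mono) auto
      have 4: "3 * K * a\<^sup>2 = 3 * (a\<^sup>2 * K)" by simp
      show ?thesis using 1 2 3 unfolding 4 by linarith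
    qed
    finally have "(\<integral>\<^sup>+y. ennreal ((q + 2 * y * L + a * (y\<^sup>2 - 1))\<^sup>2) \<partial>\<mu>) \<le> ennreal (q\<^sup>2 + (6 * L\<^sup>2 + 3 * K * a\<^sup>2))"
      by (simp add: ennreal_leI)
    also have "\<dots> = ennreal (q\<^sup>2) + (ennreal 6 * ennreal (L\<^sup>2) + ennreal (3 * K * a\<^sup>2))"
      using K_ge_1 by (simp add: ennreal_mult)
    finally show ?thesis unfolding q' q_def L_def a_def .
  qed
  have "(\<integral>\<^sup>+x. ennreal ((?q' x)\<^sup>2) \<partial>coords (insert i I)) =
      (\<integral>\<^sup>+x. \<integral>\<^sup>+y. ennreal ((?q' (x(i := y)))\<^sup>2) \<partial>\<mu> \<partial>coords I)"
    using insert.hyps by (subst coords.product_nn_integral_insert) auto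
  also have "\<dots> \<le> (\<integral>\<^sup>+x. ennreal ((?q x)\<^sup>2) + (ennreal 6 * ennreal ((?L x)\<^sup>2) + ennreal (3 * K * (p i i)\<^sup>2)) \<partial>coords I)"
    by (rule nn_integral_mono) (rule inner)
  also have "\<dots> = (\<integral>\<^sup>+x. ennreal ((?q x)\<^sup>2) \<partial>coords I) + (ennreal 6 * (\<integral>\<^sup>+x. ennreal ((?L x)\<^sup>2) \<partial>coords I)
       + ennreal (3 * K * (p i i)\<^sup>2))"
    by (subst nn_integral_add, simp, simp, subst nn_integral_add, simp, simp, subst nn_integral_cmult, simp)
       (simp add: prob_space.emeasure_space_1[OF prob_space_coords])
  also have "\<dots> \<le> ennreal (3 * K * ?S) + (ennreal 6 * ennreal ?R + ennreal (3 * K * (p i i)\<^sup>2))"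
    unfolding linear_form_second_moment[OF insert.hyps(1)]
    by (intro add_mono insert.IH) (use insert.prems in auto)
  also have "\<dots> = ennreal (3 * K * ?S + (6 * ?R + 3 * K * (p i i)\<^sup>2))"
    using K_ge_1 by (simp add: sum_nonneg ennreal_mult)
  also have "\<dots> \<le> ennreal (3 * K * (\<Sum>j\<in>insert i I. \<Sum>k\<in>insert i I. (p j k)\<^sup>2))"
  proof (rule ennreal_leI)
    have "(\<Sum>j\<in>insert i I. \<Sum>k\<in>insert i I. (p j k)\<^sup>2) = ?S + 2 * ?R + (p i i)\<^sup>2"
      using insert.hyps sym by (intro sum_insert_square_sym) auto
    moreover have "1 * ?R \<le> K * ?R" by (intro mult_right_mono K_ge_1 sum_nonneg) auto
    ultimately show "3 * K * ?S + (6 * ?R + 3 * K * (p i i)\<^sup>2) \<le> 3 * K * (\<Sum>j\<in>insert i I. \<Sum>k\<in>insert i I. (p j k)\<^sup>2)"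
      by (simp add: algebra_simps)
  qed
  finally show ?case .
qed

text \<open>Chebyshev's inequality around the trace \<open>T\<close>. For a projection the squared
  Frobenius norm equals the trace, so the variance is at most \<open>3 * K * T\<close>.\<close>

lemma quad_form_lower_tail:
  assumes P: "is_proj n P" and T: "T = (\<Sum>j<n. P j j)" "0 < T"
  shows "measure (coords {..<n}) {x \<in> space (coords {..<n}). quad_form n P x \<le> T / 2} \<le> 12 * K / T"
proof -
  interpret R: prob_space "coords {..<n}" by (rule prob_space_coords)
  let ?S = "{x \<in> space (coords {..<n}). quad_form n P x \<le> T / 2}"
  have S[measurable]: "?S \<in> sets (coords {..<n})" by measurable
  have frob: "(\<Sum>j<n. \<Sum>k<n. (P j k)\<^sup>2) = T"
    unfolding T(1)
  proof (intro sum.cong refl)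
    fix j assume "j \<in> {..<n}"
    then have j: "j < n" by simp
    have "(\<Sum>k<n. (P j k)\<^sup>2) = (\<Sum>k<n. P j k * P k j)"
      by (intro sum.cong refl) (use is_proj_sym[OF P j] in \<open>auto simp: power2_eq_square\<close>)
    then show "(\<Sum>k<n. (P j k)\<^sup>2) = P j j" by (simp add: is_proj_idem[OF P j j])
  qed
  have qf: "quad_form n P x = (\<Sum>j<n. \<Sum>k<n. P j k * x j * x k)" for x
    by (simp add: quad_form_def mat_vec_def sum_distrib_left mult_ac)
  have "ennreal (T\<^sup>2 / 4) * emeasure (coords {..<n}) ?S = (\<integral>\<^sup>+x. ennreal (T\<^sup>2 / 4) * indicator ?S x \<partial>coords {..<n})"
    by (simp add: nn_integral_cmult)
  also have "\<dots> \<le> (\<integral>\<^sup>+x. ennreal ((quad_form n P x - T)\<^sup>2) \<partial>coords {..<n})"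
  proof (intro nn_integral_mono)
    fix x
    have "T\<^sup>2 / 4 \<le> (quad_form n P x - T)\<^sup>2" if "quad_form n P x \<le> T / 2"
    proof -
      have "(T / 2)\<^sup>2 \<le> (T - quad_form n P x)\<^sup>2" using that T(2) by (intro power_mono) auto
      then show ?thesis by (simp add: power2_commute power_divide)
    qed
    then show "ennreal (T\<^sup>2 / 4) * indicator ?S x \<le> ennreal ((quad_form n P x - T)\<^sup>2)"
      by (auto simp: indicator_def intro: ennreal_leI)
  qed
  also have "\<dots> \<le> ennreal (3 * K * T)"
    using quadratic_form_variance[of "{..<n}" P] is_proj_sym[OF P] unfolding qf T(1) frob[unfolded T(1)]
    by auto
  finally have "T\<^sup>2 / 4 * measure (coords {..<n}) ?S \<le> 3 * K * T"
    using T(2) K_ge_1 by (simp add: R.emeasure_eq_measure ennreal_mult[symmetric])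
  then show ?thesis
    using T(2) by (simp add: power2_eq_square field_simps)
qed

text \<open>Deflating along the unit vector of a pivot \<open>j\<close> splits the form into
  \<open>quad_form n P' x\<close>, which does not involve \<open>x j\<close>, plus the square of the
  \<open>j\<close>-th entry of \<open>P x\<close> over \<open>P j j\<close>. If the form is small,
  so are both parts: the second costs a factor 1 - c given the other coordinates, and the first has
  a projection of trace one less.\<close>

lemma quad_form_small_ball:
  assumes "is_proj n P" "real d \<le> (\<Sum>j<n. P j j)"
  shows "measure (coords {..<n}) {x \<in> space (coords {..<n}). quad_form n P x \<le> 1 / (4 * real n)} \<le> (1 - c) ^ d"
  using assms
proof (induction d arbitrary: P)
  case 0
  show ?case by (simp add: prob_space.prob_le_1[OF prob_space_coords])
next
  case (Suc d)
  note P = Suc.prems(1)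
  have "1 \<le> (\<Sum>j<n. P j j)" using Suc.prems(2) by simp
  then have "\<exists>j<n. 1 / n \<le> P j j" by (rule exists_large_diagonal)
  then obtain j where j: "j < n" "1 / n \<le> P j j" by blast
  then have n: "0 < real n" and pos: "0 < P j j" by (auto intro: less_le_trans[of _ "1 / real n"])
  define e :: "nat \<Rightarrow> real" where "e k = (if k = j then 1 else 0)" for k
  have e: "mat_vec n P e k = P k j" for k
    using j by (simp add: mat_vec_def e_def if_distrib cong: if_cong)
  have qe: "quad_form n P e = P j j"
    using j unfolding quad_form_def e by (simp add: e_def if_distribR if_distrib cong: if_cong)
  define P' where "P' = deflate n P e"
  have P': "is_proj n P'" unfolding P'_def by (rule is_proj_deflate[OF P])
  have inner: "(\<Sum>k<n. mat_vec n P e k * x k) = mat_vec n P x j" for x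
    unfolding e mat_vec_def[of n P x] using is_proj_sym[OF P _ j(1)] by (intro sum.cong refl) auto
  have q: "quad_form n P x = quad_form n P' x + (mat_vec n P x j)\<^sup>2 / P j j" for x
    unfolding P'_def quad_form_deflate qe inner by simp
  have zero: "P' k j = 0" if "k < n" for k
    using pos by (simp add: P'_def deflate_def e qe)
  let ?A = "\<lambda>P. {x \<in> space (coords {..<n}). quad_form n P x \<le> 1 / (4 * real n)}"
  have "measure (coords {..<n}) (?A P) \<le> (1 - c) * measure (coords {..<n}) (?A P')"
  proof (rule measure_PiM_le_conditional[where i=j])
    show "?A P \<subseteq> ?A P'"
      using pos by (auto simp: q intro: order_trans[rotated])
    fix x y
    assume "x \<in> space (coords {..<n})"
    have "mat_vec n P' (x(j := y)) k = mat_vec n P' x k" if "k < n" for k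
      unfolding mat_vec_def using zero[OF that] by (intro sum.cong refl) auto
    then have "quad_form n P' (x(j := y)) = quad_form n P' x"
      by (simp add: quad_form_eq_sum_squares[OF P'])
    moreover have "x(j := y) \<in> space (coords {..<n})"
      using \<open>x \<in> space _\<close> j by (auto simp: space_PiM PiE_def extensional_def)
    ultimately show "x(j := y) \<in> ?A P' \<longleftrightarrow> x \<in> ?A P'" using \<open>x \<in> space _\<close> by simp
  next
    fix x
    define s where "s = (\<Sum>k\<in>{..<n}-{j}. P j k * x k)"
    have s: "mat_vec n P (x(j := y)) j = P j j * y + s" for y
      unfolding mat_vec_def s_def using j by (subst sum.remove[of _ j]) (auto intro!: sum.cong)
    \<comment> \<open>Since 1/n is at most \<open>P j j\<close>, the threshold 1/(4n) is at most
      \<open>P j j / 4\<close>; this is exactly what confines \<open>y\<close> to an interval of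
      length 1.\<close>
    have "{y \<in> space \<mu>. x(j := y) \<in> ?A P} \<subseteq> {y. \<bar>y - (- s / P j j)\<bar> \<le> 1 / 2}"
    proof safe
      fix y assume "quad_form n P (x(j := y)) \<le> 1 / (4 * real n)"
      then have "(P j j * y + s)\<^sup>2 / P j j \<le> 1 / (4 * real n)"
        using quad_form_nonneg[OF P', of "x(j := y)"] unfolding q s by simp
      also have "\<dots> \<le> P j j / 4" using j(2) by simp
      finally have "(P j j * y + s)\<^sup>2 \<le> (P j j / 2)\<^sup>2"
        using pos by (simp add: power2_eq_square field_simps)
      then have "\<bar>P j j * y + s\<bar> \<le> P j j / 2"
        using pos by (intro power2_le_imp_le[of "\<bar>_\<bar>"]) auto
      also have "P j j * y + s = P j j * (y - (- s / P j j))" using pos by (simp add: field_simps)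
      finally show "\<bar>y - (- s / P j j)\<bar> \<le> 1 / 2" using pos by (simp add: abs_mult)
    qed
    then have "measure \<mu> {y \<in> space \<mu>. x(j := y) \<in> ?A P} \<le> measure \<mu> {y. \<bar>y - (- s / P j j)\<bar> \<le> 1 / 2}"
      by (intro finite_measure_mono) auto
    also have "\<dots> \<le> 1 - c" by (rule small_ball)
    finally show "measure \<mu> {y \<in> space \<mu>. x(j := y) \<in> ?A P} \<le> 1 - c" .
  qed (use j c_bounds prob_space_axioms in auto)
  also have "\<dots> \<le> (1 - c) * (1 - c) ^ d"
    using c_bounds pos Suc.prems(2)
    by (intro mult_left_mono Suc.IH P') (auto simp: P'_def trace_deflate[OF P] qe)
  finally show ?case by simp
qed

end

section \<open>A Littlewood--Offord estimate\<close>

text \<open>Disjoint half-open intervals of common length \<open>g\<close> are encoded by the finite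
  set of their left endpoints: separation by \<open>g\<close> makes the \<open>cells\<close>
  disjoint, and translating the union means translating the endpoints.\<close>

definition separated :: "real \<Rightarrow> real set \<Rightarrow> bool" where
  "separated g B \<longleftrightarrow> (\<forall>b\<in>B. \<forall>b'\<in>B. b < b' \<longrightarrow> b + g \<le> b')"

definition cells :: "real \<Rightarrow> real set \<Rightarrow> real set" where
  "cells g B = (\<Union>b\<in>B. {b..<b + g})"

lemma separated_shift: "separated g B \<Longrightarrow> separated g ((\<lambda>b. b - v) ` B)"
  by (force simp: separated_def)

lemma separated_Diff: "separated g B \<Longrightarrow> separated g (B - C)"
  by (auto simp: separated_def)

lemma cells_shift: "s \<in> cells g ((\<lambda>b. b - v) ` B) \<longleftrightarrow> s + v \<in> cells g B"
  by (auto simp: cells_def algebra_simps)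

lemma cells_measurable[measurable]: "finite B \<Longrightarrow> cells g B \<in> sets borel"
  unfolding cells_def by (intro sets.finite_UN) auto

text \<open>The rightmost cell of \<open>B\<close> is handed over to the translate \<open>C\<close>.
  Because \<open>g \<le> v\<close>, it lies to the right of every cell of \<open>C\<close> and stays
  disjoint from them, so k and k cells are traded for k + 1 and k - 1.\<close>

lemma (in prob_space) cells_exchange:
  fixes S :: "'a \<Rightarrow> real"
  assumes S[measurable]: "S \<in> borel_measurable M" and B: "finite B" "B \<noteq> {}" "separated g B"
    and g: "0 < g" "g \<le> v"
  defines "h \<equiv> (\<lambda>B. prob {x \<in> space M. S x \<in> cells g B})"
    and "C \<equiv> (\<lambda>b. b - v) ` B"
  shows "h B + h C \<le> h (insert (Max B) C) + h (B - {Max B})"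
    and "separated g (insert (Max B) C)" "card (insert (Max B) C) = Suc (card B)"
proof -
  have M: "b \<le> Max B" if "b \<in> B" for b using B that by simp
  have MB: "Max B \<in> B" using B by simp
  have C: "b + g \<le> Max B" if "b \<in> C" for b
    using that M g by (force simp: C_def)
  show "separated g (insert (Max B) C)"
    using separated_shift[OF B(3), of v] C g unfolding C_def[symmetric] separated_def by force
  have notin: "Max B \<notin> C" using C g by force
  have "card C = card B" unfolding C_def by (intro card_image) (auto simp: inj_on_def)
  then show "card (insert (Max B) C) = Suc (card B)"
    using notin B by (simp add: C_def)
  have fC[measurable]: "finite C" "finite B" "finite (B - {Max B})" using B by (auto simp: C_def)
  let ?E = "\<lambda>B. {x \<in> space M. S x \<in> cells g B}"
  have [measurable]: "finite B \<Longrightarrow> ?E B \<in> events" for B by measurable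
  have "h (insert (Max B) C) = prob (?E {Max B} \<union> ?E C)"
    unfolding h_def by (intro arg_cong[where f=prob]) (auto simp: cells_def)
  also have "\<dots> = h {Max B} + h C"
    unfolding h_def
  proof (rule finite_measure_Union)
    show "?E {Max B} \<inter> ?E C = {}" using C by (force simp: cells_def)
  qed (use fC in auto)
  finally have 1: "h (insert (Max B) C) = h {Max B} + h C" .
  have "h B = prob (?E {Max B} \<union> ?E (B - {Max B}))"
    unfolding h_def using MB by (intro arg_cong[where f=prob]) (auto simp: cells_def)
  also have "\<dots> \<le> h {Max B} + h (B - {Max B})"
    unfolding h_def by (intro measure_Un_le) (use fC in auto)
  finally show "h B + h C \<le> h (insert (Max B) C) + h (B - {Max B})" using 1 by simp
qed

context entry_law
begin

text \<open>
  An upper estimate for the probability that a lazy simple random walk started at \<open>k\<close>, moving at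
  each step with probability at least \<open>c\<close>, is not absorbed at \<open>0\<close> within \<open>r\<close> steps: the first
  summand accounts for reaching \<open>N\<close> first, the second one for staying strictly between \<open>0\<close> and \<open>N\<close>.
\<close>

definition walk_bound :: "nat \<Rightarrow> nat \<Rightarrow> nat \<Rightarrow> real" where
  "walk_bound N r k = k / N + k * (real N - k) / (c * (r + 1))"

text \<open>Induction over the summands. A coefficient below \<open>a\<close> only averages the
  bound over translates. For a larger one, two independent values of the coordinate differ by more
  than 1/2 with probability at least \<open>c\<close>, and then the two translates are at least
  \<open>a / 2\<close> apart, so that \<open>cells_exchange\<close> makes one step of the walk. The
  second summand of \<open>walk_bound\<close> is Markov's inequality at time r + 1 for an exit time
  of mean at most k (N - k) / c.\<close>

lemma linear_form_small_ball:
  assumes "finite I" "0 < a" "finite B" "separated (a / 2) B" "card B \<le> N" "1 \<le> N"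
    and "r = card {i \<in> I. a \<le> \<bar>w i\<bar>}"
  shows "measure (coords I) {x \<in> space (coords I). (\<Sum>i\<in>I. w i * x i) \<in> cells (a / 2) B} \<le> walk_bound N r (card B)"
  using assms
proof (induction I arbitrary: B r)
  case empty
  interpret R: prob_space "coords {}" by (rule prob_space_coords)
  have r: "r = 0" using empty by simp
  let ?p = "measure (coords {}) {x \<in> space (coords {}). (\<Sum>i\<in>{}. w i * x i) \<in> cells (a / 2) B}"
  \<comment> \<open>Without summands the walk has made no step: the bound is at least 1 for every
    nonempty \<open>B\<close>, so only the empty union needs a genuine estimate.\<close>
  consider "B = {}" | "card B = N" | "1 \<le> card B" "card B < N"
    using empty.prems(2,4) by (cases "card B = 0"; fastforce)
  then show ?case
  proof cases
    case 3
    have "1 * 1 \<le> real (card B) * (real N - real (card B))" using 3 by (intro mult_mono) auto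
    then have "1 \<le> real (card B) * (real N - real (card B)) / c" using c_bounds by (simp add: field_simps)
    moreover have "0 \<le> real (card B) / N" by simp
    moreover have "walk_bound N r (card B) = real (card B) / N + real (card B) * (real N - real (card B)) / c"
      by (simp add: walk_bound_def r)
    ultimately have "1 \<le> walk_bound N r (card B)" by linarith
    then show ?thesis using R.prob_le_1 order_trans by blast
  next
    case 2
    then have "1 = walk_bound N r (card B)" using empty.prems(5) by (simp add: walk_bound_def)
    then show ?thesis using R.prob_le_1 by simp
  qed (simp add: cells_def walk_bound_def)
next
  case (insert i I)
  interpret R: prob_space "coords I" by (rule prob_space_coords)
  interpret R': prob_space "coords (insert i I)" by (rule prob_space_coords)
  define k where "k = card B"
  define A where "A = {x \<in> space (coords (insert i I)). (\<Sum>i\<in>insert i I. w i * x i) \<in> cells (a / 2) B}"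
  have [measurable]: "finite B" by fact
  have A[measurable]: "A \<in> sets (coords (insert i I))"
    unfolding A_def by measurable
  define h where "h B = measure (coords I) {x \<in> space (coords I). (\<Sum>i\<in>I. w i * x i) \<in> cells (a / 2) B}" for B
  define C where "C y = (\<lambda>b. b - w i * y) ` B" for y
  define r' where "r' = card {i \<in> I. a \<le> \<bar>w i\<bar>}"
  have IH: "h D \<le> walk_bound N r' (card D)" if "finite D" "separated (a / 2) D" "card D \<le> N" for D
    unfolding h_def using that insert.prems by (intro insert.IH) (auto simp: r'_def)
  have C: "finite (C y)" "separated (a / 2) (C y)" "card (C y) = k" for y
    using insert.prems by (auto simp: C_def k_def separated_shift card_image inj_on_def)
  have kN: "k \<le> N" using insert.prems by (simp add: k_def)
  have hC: "measure (coords I) {x \<in> space (coords I). x(i := y) \<in> A} = h (C y)" for y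
  proof -
    have "(\<Sum>j\<in>insert i I. w j * (x(i := y)) j) = (\<Sum>j\<in>I. w j * x j) + w i * y" for x
      using insert.hyps by (simp, intro sum.cong) auto
    moreover have "x(i := y) \<in> space (coords (insert i I))" if "x \<in> space (coords I)" for x
      using that by (auto simp: space_PiM PiE_def extensional_def)
    ultimately show ?thesis
      unfolding h_def C_def A_def cells_shift by (intro arg_cong[where f="measure (coords I)"]) auto
  qed
  define \<Psi> where "\<Psi> = measure (coords (insert i I)) A"
  have \<Psi>: "integrable \<mu> (\<lambda>y. h (C y))" "\<Psi> = (\<integral>y. h (C y) \<partial>\<mu>)"
    unfolding \<Psi>_def hC[symmetric]
    by (intro measure_PiM_insert prob_space_axioms insert.hyps A)+
  have le1: "\<Psi> \<le> 1" unfolding \<Psi>_def by simp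
  show ?case
  proof (cases "a \<le> \<bar>w i\<bar>")
    case False
    then have "{j \<in> insert i I. a \<le> \<bar>w j\<bar>} = {j \<in> I. a \<le> \<bar>w j\<bar>}" by auto
    then have r: "r = r'" using insert.prems by (simp add: r'_def)
    have "\<Psi> \<le> (\<integral>y. walk_bound N r k \<partial>\<mu>)"
      unfolding \<Psi>(2) by (intro integral_mono \<Psi>(1)) (use IH[OF C(1,2)] C(3) kN r in auto)
    then show ?thesis unfolding \<Psi>_def A_def k_def by simp
  next
    case True
    then have "{j \<in> insert i I. a \<le> \<bar>w j\<bar>} = insert i {j \<in> I. a \<le> \<bar>w j\<bar>}" by auto
    then have r: "r = Suc r'" using insert.prems insert.hyps by (simp add: r'_def)
    consider "k = 0" | "k = N" | "1 \<le> k" "k < N" using kN by linarith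
    then have "\<Psi> \<le> walk_bound N r k"
    proof cases
      case 1
      then have "B = {}" using insert.prems by (simp add: k_def)
      then show ?thesis using 1 by (simp add: \<Psi>_def A_def cells_def walk_bound_def)
    next
      case 2
      then have "walk_bound N r k = 1" using insert.prems by (simp add: walk_bound_def)
      then show ?thesis using le1 by simp
    next
      case 3
      define H where "H = walk_bound N r'"
      \<comment> \<open>The second difference of k (N - k) is -2. The restriction
        \<open>k < N\<close> keeps k + 1 cells within reach of the induction hypothesis.\<close>
      have HH: "H (Suc k) + H (k - 1) = 2 * H k - 2 / (c * (r' + 1))"
      proof -
        have "real (k - 1) = real k - 1" using 3 by simp
        then show ?thesis
          using insert.prems(5) c_bounds unfolding H_def walk_bound_def
          by (simp add: diff_divide_distrib[symmetric] add_divide_distrib[symmetric] algebra_simps)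
      qed
      have pairH: "h (C y) + h (C z) \<le> H (Suc k) + H (k - 1)" if yz: "a / 2 \<le> w i * (z - y)" for y z
      proof -
        let ?v = "w i * (z - y)" and ?m = "Max (C y)"
        have Cz: "C z = (\<lambda>b. b - ?v) ` C y"
          unfolding C_def image_image by (intro image_cong refl) (simp add: algebra_simps)
        have ne: "C y \<noteq> {}" using C(3)[of y] 3 by auto
        note ex = R.cells_exchange[OF _ C(1)[of y] ne C(2)[of y] _ yz, of "\<lambda>x. \<Sum>i\<in>I. w i * x i",
            folded h_def Cz]
        have m: "(\<lambda>x. \<Sum>i\<in>I. w i * x i) \<in> borel_measurable (coords I)" by measurable
        have a2: "0 < a / 2" using insert.prems by simp
        have "h (C y) + h (C z) \<le> h (insert ?m (C z)) + h (C y - {?m})" by (rule ex(1)[OF m a2])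
        also have "\<dots> \<le> H (card (insert ?m (C z))) + H (card (C y - {?m}))"
          unfolding H_def using ex(2,3)[OF m a2] 3 C
          by (intro add_mono IH) (auto simp: separated_Diff card_Diff_singleton ne)
        also have "card (insert ?m (C z)) = Suc k" using ex(3)[OF m a2] C(3) by simp
        also have "card (C y - {?m}) = k - 1" using C ne by (simp add: card_Diff_singleton)
        finally show ?thesis .
      qed
      have pair: "h (C y) + h (C z) \<le> 2 * H k - 2 / (c * (r' + 1)) * indicator {z. 1 / 2 < \<bar>z - y\<bar>} z" for y z
      proof (cases "1 / 2 < \<bar>z - y\<bar>")
        case True
        have "a * (1 / 2) \<le> \<bar>w i\<bar> * \<bar>z - y\<bar>"
          using True \<open>a \<le> \<bar>w i\<bar>\<close> insert.prems by (intro mult_mono) auto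
        then have "a / 2 \<le> w i * (z - y) \<or> a / 2 \<le> w i * (y - z)"
          unfolding abs_mult[symmetric] by (auto simp: abs_if algebra_simps split: if_splits)
        then show ?thesis using pairH[of z y] pairH[of y z] HH True by auto
      next
        case False
        then show ?thesis
          using IH[OF C(1,2), of y] IH[OF C(1,2), of z] C(3) kN by (simp add: H_def)
      qed
      \<comment> \<open>The variable z is integrated first with y fixed, so that
        \<open>far_probability\<close> applies around y; integrating y afterwards yields
        \<open>\<Psi>\<close> twice.\<close>
      have half: "h (C y) + \<Psi> \<le> 2 * H k - 2 / (r' + 1)" for y
      proof -
        define F where "F = {z. 1 / 2 < \<bar>z - y\<bar>}"
        have [simp, measurable]: "F \<in> sets borel" by (simp add: F_def)
        have [simp]: "integrable \<mu> (indicat_real F)"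
          by (rule integrable_real_indicator) (auto simp: less_top[symmetric])
        have "h (C y) + \<Psi> = (\<integral>z. h (C y) + h (C z) \<partial>\<mu>)"
          unfolding \<Psi>(2) using \<Psi>(1) by simp
        also have "\<dots> \<le> (\<integral>z. 2 * H k - 2 / (c * (r' + 1)) * indicator F z \<partial>\<mu>)"
          using \<Psi>(1) by (intro integral_mono pair[of y, folded F_def]) auto
        also have "\<dots> = 2 * H k - 2 / (c * (r' + 1)) * prob F"
          by simp
        also have "\<dots> \<le> 2 * H k - 2 / (c * (r' + 1)) * c"
          using far_probability[of y, folded F_def] c_bounds by (intro diff_left_mono mult_left_mono) auto
        also have "\<dots> = 2 * H k - 2 / (r' + 1)" using c_bounds by simp
        finally show ?thesis .
      qed
      have "\<Psi> + \<Psi> = (\<integral>y. h (C y) + \<Psi> \<partial>\<mu>)"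
        unfolding \<Psi>(2) using \<Psi>(1) by simp
      also have "\<dots> \<le> (\<integral>y. 2 * H k - 2 / (r' + 1) \<partial>\<mu>)"
        by (intro integral_mono Bochner_Integration.integrable_add \<Psi>(1) half) auto
      also have "\<dots> = 2 * H k - 2 / (r' + 1)" by simp
      finally have \<Psi>H: "\<Psi> \<le> H k - 1 / (r' + 1)" by simp
      \<comment> \<open>Replacing r' + 1 by r' + 2 lowers the second summand by t / ((r' + 1) (r' +
        2)). The gain 1 / (r' + 1) pays for this when t <= r' + 2; otherwise the bound to be proved
        is at least 1.\<close>
      define t where "t = real k * (real N - k) / c"
      have W: "H k = k / N + t / (r' + 1)" "walk_bound N r k = k / N + t / (r' + 2)"
        unfolding H_def walk_bound_def t_def r by (simp_all add: add.commute)
      show ?thesis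
      proof (cases "t \<le> r' + 2")
        case True
        have "t / (r' + 1) - t / (r' + 2) = t / (r' + 2) * (1 / (r' + 1))" by (simp add: field_simps)
        also have "\<dots> \<le> 1 * (1 / (r' + 1))" using True by (intro mult_right_mono) (auto simp: field_simps)
        finally show ?thesis using \<Psi>H W by simp
      next
        case False
        then have "1 \<le> t / (r' + 2)" by (simp add: field_simps)
        moreover have "0 \<le> real k / N" by simp
        ultimately show ?thesis using le1 W(2) by linarith
      qed
    qed
    then show ?thesis unfolding \<Psi>_def A_def k_def .
  qed
qed

text \<open>A single cell, [-a/8, 3a/8), contains the whole range. The barrier \<open>N\<close>
  remains free; N of order sqrt r would give the classical decay r^(-1/2).\<close>

lemma linear_form_abs_small_ball:
  assumes "finite I" "0 < a" "1 \<le> N" "r \<le> card {i \<in> I. a \<le> \<bar>w i\<bar>}"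
  shows "measure (coords I) {x \<in> space (coords I). \<bar>\<Sum>i\<in>I. w i * x i\<bar> \<le> a / 8} \<le> 1 / real N + real N / (c * (r + 1))"
proof -
  interpret R: prob_space "coords I" by (rule prob_space_coords)
  let ?r = "card {i \<in> I. a \<le> \<bar>w i\<bar>}"
  have "measure (coords I) {x \<in> space (coords I). \<bar>\<Sum>i\<in>I. w i * x i\<bar> \<le> a / 8} \<le>
     measure (coords I) {x \<in> space (coords I). (\<Sum>i\<in>I. w i * x i) \<in> cells (a / 2) {- a / 8}}"
    using assms(2) by (intro R.finite_measure_mono) (auto simp: cells_def)
  also have "\<dots> \<le> walk_bound N ?r (card {- a / 8})"
    using assms by (intro linear_form_small_ball) (auto simp: separated_def)
  also have "\<dots> \<le> 1 / real N + real N / (c * (?r + 1))"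
    using c_bounds by (auto simp: walk_bound_def add.commute intro!: divide_right_mono)
  also have "\<dots> \<le> 1 / real N + real N / (c * (r + 1))"
    using c_bounds assms by (intro add_left_mono divide_left_mono mult_left_mono) auto
  finally show ?thesis .
qed

end

section \<open>Normal vectors are not sparse\<close>

definition grid_vec :: "nat \<Rightarrow> (nat \<times> int) list \<Rightarrow> nat \<Rightarrow> real" where
  "grid_vec N xs k = (case map_of xs k of None \<Rightarrow> 0 | Some z \<Rightarrow> real_of_int z / real N)"

text \<open>Vectors with at most \<open>m\<close> nonzero entries, which are multiples of 1/(2 n^3)
  bounded by n. Lists make the counting immediate; several lists for one vector do no harm in a
  union bound. The entry equal to 1 gives every row a coordinate with coefficient 1, to which
  \<open>small_ball\<close> applies.\<close>

definition sparse_grid :: "nat \<Rightarrow> nat \<Rightarrow> (nat \<times> int) list set" where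
  "sparse_grid n m = {xs. set xs \<subseteq> {..<n} \<times> {- int (2 * n ^ 4)..int (2 * n ^ 4)} \<and> length xs = m
     \<and> (\<exists>j<n. grid_vec (2 * n ^ 3) xs j = 1)}"

definition nearly_orthogonal_sparse :: "nat \<Rightarrow> nat \<Rightarrow> (nat \<Rightarrow> nat \<Rightarrow> real) \<Rightarrow> nat \<Rightarrow> bool" where
  "nearly_orthogonal_sparse n m X i \<longleftrightarrow>
     (\<exists>xs\<in>sparse_grid n m. \<forall>l<i. \<bar>\<Sum>k<n. grid_vec (2 * n ^ 3) xs k * X l k\<bar> \<le> 1 / 2)"

lemma finite_sparse_grid: "finite (sparse_grid n m)"
  and card_sparse_grid: "card (sparse_grid n m) \<le> (n * (4 * n ^ 4 + 1)) ^ m"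
proof -
  let ?A = "{..<n} \<times> {- int (2 * n ^ 4)..int (2 * n ^ 4)}"
  have sub: "sparse_grid n m \<subseteq> {xs. set xs \<subseteq> ?A \<and> length xs = m}"
    by (auto simp: sparse_grid_def)
  have fin: "finite {xs. set xs \<subseteq> ?A \<and> length xs = m}"
    by (rule finite_lists_length_eq) simp
  show "finite (sparse_grid n m)" using sub fin by (rule finite_subset)
  have "card (sparse_grid n m) \<le> card {xs. set xs \<subseteq> ?A \<and> length xs = m}"
    using fin sub by (rule card_mono)
  also have "\<dots> = card ?A ^ m" by (rule card_lists_length_eq) simp
  also have "card ?A = n * (4 * n ^ 4 + 1)"
    by (simp add: card_cartesian_product nat_add_distrib nat_mult_distrib nat_power_eq)
  finally show "card (sparse_grid n m) \<le> (n * (4 * n ^ 4 + 1)) ^ m" .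
qed

lemma nearly_orthogonal_sparse_antimono:
  "nearly_orthogonal_sparse n m X i \<Longrightarrow> i' \<le> i \<Longrightarrow> nearly_orthogonal_sparse n m X i'"
  unfolding nearly_orthogonal_sparse_def by (meson less_le_trans)

text \<open>The vector \<open>w\<close> is the pivot row of the projection divided by its diagonal
  entry, hence orthogonal to the earlier rows, with a coordinate equal to 1 and all coordinates at
  most n in absolute value. If it were small outside fewer than \<open>m\<close> coordinates,
  rounding it would give a sparse grid vector nearly orthogonal to these rows.\<close>

lemma spread_normal_vector:
  assumes i: "i < n" and m: "m \<le> n"
    and bounded: "\<And>l k. l < i \<Longrightarrow> k < n \<Longrightarrow> \<bar>X l k\<bar> \<le> (real n)\<^sup>2"
    and not_sparse: "\<not> nearly_orthogonal_sparse n m X i"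
  obtains w where "m \<le> card {k \<in> {..<n}. 1 / (2 * real n ^ 3) \<le> \<bar>w k\<bar>}"
    "\<And>x. (\<Sum>k<n. w k * x k)\<^sup>2 \<le> (real n)\<^sup>2 * quad_form n (row_proj n X i) x"
proof -
  define P where "P = row_proj n X i"
  have P: "is_proj n P" unfolding P_def by (rule is_proj_row_proj)
  have "1 \<le> (\<Sum>j<n. P j j)" using trace_row_proj[of n i X] i by (simp add: P_def)
  then obtain j where j: "j < n" "1 / n \<le> P j j" using exists_large_diagonal by blast
  have n: "0 < real n" and n1: "1 \<le> real n" using i by auto
  have pos: "0 < P j j" by (rule less_le_trans[OF _ j(2)]) (use n in simp)
  define w where "w k = P j k / P j j" for k
  have w: "(\<Sum>k<n. w k * x k) = mat_vec n P x j / P j j" for x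
    unfolding w_def mat_vec_def sum_divide_distrib by (intro sum.cong refl) simp
  have inv: "1 / P j j \<le> n" using j(2) pos n by (simp add: field_simps)
  have quad: "(\<Sum>k<n. w k * x k)\<^sup>2 \<le> (real n)\<^sup>2 * quad_form n P x" for x
  proof -
    have "(\<Sum>k<n. w k * x k)\<^sup>2 = (1 / P j j)\<^sup>2 * (mat_vec n P x j)\<^sup>2"
      unfolding w by (simp add: power_divide)
    also have "\<dots> \<le> (real n)\<^sup>2 * quad_form n P x"
      using inv pos mat_vec_square_le_quad_form[OF P j(1)] by (intro mult_mono power_mono) auto
    finally show ?thesis .
  qed
  have wn: "\<bar>w k\<bar> \<le> n" if k: "k < n" for k
  proof -
    have "(P j k)\<^sup>2 \<le> (\<Sum>l<n. (P j l)\<^sup>2)" by (rule member_le_sum) (use k in auto)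
    also have "\<dots> = (\<Sum>l<n. P j l * P l j)"
      by (intro sum.cong refl) (use is_proj_sym[OF P j(1)] in \<open>auto simp: power2_eq_square\<close>)
    also have "\<dots> = P j j" by (rule is_proj_idem[OF P j(1) j(1)])
    finally have "(w k)\<^sup>2 \<le> 1 / P j j"
      using pos by (simp add: w_def power_divide power2_eq_square field_simps)
    also have "\<dots> \<le> (real n)\<^sup>2" using inv self_le_power[OF n1, of 2] by linarith
    finally show ?thesis using n by (intro power2_le_imp_le[of "\<bar>w k\<bar>"]) auto
  qed
  have orth: "(\<Sum>k<n. w k * X l k) = 0" if "l < i" for l
    unfolding w P_def by (simp add: row_proj_kills_earlier_rows[OF that j(1)])
  have wj: "w j = 1" using pos by (simp add: w_def)
  define N :: nat where "N = 2 * n ^ 3"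
  have N: "0 < real N" using n by (simp add: N_def)
  define S where "S = {k \<in> {..<n}. 1 / (2 * real n ^ 3) \<le> \<bar>w k\<bar>}"
  have "m \<le> card S"
  proof (rule ccontr)
    assume "\<not> m \<le> card S"
    \<comment> \<open>The large coordinates are padded to exactly \<open>m\<close> positions, the
      list length fixed in \<open>sparse_grid\<close>.\<close>
    then obtain S' where S': "S \<subseteq> S'" "S' \<subseteq> {..<n}" "card S' = m"
      using exists_subset_between[of S m "{..<n}"] m by (auto simp: S_def)
    have fS': "finite S'" using S' finite_subset by blast
    define xs where "xs = map (\<lambda>k. (k, \<lfloor>real N * w k\<rfloor>)) (sorted_list_of_set S')"
    define v where "v = grid_vec N xs"
    have v: "v k = (if k \<in> S' then real_of_int \<lfloor>real N * w k\<rfloor> / N else 0)" for k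
      using fS' by (simp add: v_def grid_vec_def xs_def map_of_map_restrict restrict_map_def)
    have close: "\<bar>v k - w k\<bar> \<le> 1 / N" if "k < n" for k
    proof (cases "k \<in> S'")
      case True
      have "\<bar>real_of_int \<lfloor>real N * w k\<rfloor> - real N * w k\<bar> \<le> 1" by linarith
      moreover have "v k - w k = (real_of_int \<lfloor>real N * w k\<rfloor> - real N * w k) / N"
        using True N by (simp add: v field_simps)
      ultimately show ?thesis using N by (simp add: abs_divide divide_right_mono)
    next
      case False
      then have "k \<notin> S" using S' by auto
      then show ?thesis using False that by (simp add: v S_def N_def)
    qed
    have "1 / (2 * real n ^ 3) \<le> 1"
      using one_le_power[OF n1, of 3] by (auto simp: divide_le_eq_1)
    then have "j \<in> S'" using S' j wj by (auto simp: S_def)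
    \<comment> \<open>Rounding leaves \<open>w j = 1\<close> intact because \<open>N\<close> is an
      integer.\<close>
    then have vj: "v j = 1" using N by (simp add: v wj)
    have rng: "- int (2 * n ^ 4) \<le> \<lfloor>real N * w k\<rfloor>" "\<lfloor>real N * w k\<rfloor> \<le> int (2 * n ^ 4)" if "k < n" for k
    proof -
      have "\<bar>real N * w k\<bar> \<le> real N * n"
        using wn[OF that] N by (simp add: abs_mult)
      also have "\<dots> = real (2 * n ^ 4)" by (simp add: N_def power4_eq_xxxx power3_eq_cube)
      finally have "\<bar>real N * w k\<bar> \<le> real_of_int (int (2 * n ^ 4))" by simp
      then have *: "- real_of_int (int (2 * n ^ 4)) \<le> real N * w k" "real N * w k \<le> real_of_int (int (2 * n ^ 4))"
        by linarith+
      show "- int (2 * n ^ 4) \<le> \<lfloor>real N * w k\<rfloor>"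
        unfolding le_floor_iff using *(1) by (simp del: of_nat_mult of_nat_power)
      show "\<lfloor>real N * w k\<rfloor> \<le> int (2 * n ^ 4)"
        using floor_mono[OF *(2)] by (simp only: floor_of_int)
    qed
    have "xs \<in> sparse_grid n m"
      unfolding sparse_grid_def
      using rng S' fS' j vj by (auto simp: xs_def v_def N_def)
    moreover have "\<bar>\<Sum>k<n. v k * X l k\<bar> \<le> 1 / 2" if "l < i" for l
    proof -
      have "(\<Sum>k<n. v k * X l k) = (\<Sum>k<n. (v k - w k) * X l k)"
        using orth[OF that] by (simp add: left_diff_distrib sum_subtractf)
      also have "\<bar>\<dots>\<bar> \<le> (\<Sum>k<n. \<bar>(v k - w k) * X l k\<bar>)" by (rule sum_abs)
      also have "\<dots> \<le> (\<Sum>k<n. 1 / N * (real n)\<^sup>2)"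
        unfolding abs_mult using close bounded[OF that] by (intro sum_mono mult_mono) auto
      \<comment> \<open>There are n terms of size at most n^2 / (2 n^3); this balance fixes the mesh
        1/(2 n^3).\<close>
      also have "\<dots> = 1 / 2" using n by (simp add: N_def power2_eq_square power3_eq_cube)
      finally show ?thesis .
    qed
    ultimately show False using not_sparse unfolding nearly_orthogonal_sparse_def v_def N_def by blast
  qed
  then show ?thesis using that quad unfolding S_def P_def by blast
qed

section \<open>The random matrix as a product measure and estimates for one row\<close>

context entry_law
begin

text \<open>A nested product instead of one over pairs of indices: a whole row is a single
  coordinate of the outer product and can be resampled with all other rows fixed.\<close>

abbreviation "ensemble n \<equiv> PiM {..<n} (\<lambda>_::nat. coords {..<n})"

lemma prob_space_ensemble: "prob_space (ensemble n)"
  by (intro prob_space_PiM prob_space_coords)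

lemma measurable_entry: "i < n \<Longrightarrow> k < n \<Longrightarrow> (\<lambda>X. X i k) \<in> borel_measurable (ensemble n)"
proof -
  assume "i < n" "k < n"
  then have "(\<lambda>X. X i) \<in> ensemble n \<rightarrow>\<^sub>M coords {..<n}" "(\<lambda>x. x k) \<in> coords {..<n} \<rightarrow>\<^sub>M \<mu>"
    by (auto intro: measurable_component_singleton)
  from measurable_compose[OF this] show ?thesis by (simp cong: measurable_cong_sets)
qed

lemma measurable_row_proj:
  "i \<le> n \<Longrightarrow> j < n \<Longrightarrow> k < n \<Longrightarrow> (\<lambda>X. row_proj n X i j k) \<in> borel_measurable (ensemble n)"
proof (induction i arbitrary: j k)
  case (Suc i)
  have P: "(\<lambda>X. row_proj n X i j k) \<in> borel_measurable (ensemble n)" if "j < n" "k < n" for j k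
    using Suc.IH Suc.prems(1) that by simp
  have x: "(\<lambda>X. X i k) \<in> borel_measurable (ensemble n)" if "k < n" for k
    using Suc.prems(1) that by (intro measurable_entry) auto
  note mv = measurable_mat_vec[of n "\<lambda>X. row_proj n X i" "ensemble n" "\<lambda>X. X i", OF P x]
  note qf = measurable_quad_form[of n "\<lambda>X. row_proj n X i" "ensemble n" "\<lambda>X. X i", OF P x]
  show ?case
    unfolding row_proj.simps deflate_def
    by (rule borel_measurable_diff[OF P[OF Suc.prems(2,3)]
          borel_measurable_divide[OF borel_measurable_times[OF mv[OF _ _ _ Suc.prems(2)] mv[OF _ _ _ Suc.prems(3)]] qf]])
qed simp

lemma measurable_row_dist2[measurable]:
  "i < n \<Longrightarrow> (\<lambda>X. row_dist2 n X i) \<in> borel_measurable (ensemble n)"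
  unfolding row_dist2_def
  by (rule measurable_quad_form[of n "\<lambda>X. row_proj n X i" "ensemble n" "\<lambda>X. X i"])
     (simp_all only: measurable_row_proj measurable_entry less_imp_le)

lemma measure_ensemble_le_conditional:
  assumes i: "i < n" and A: "A \<in> sets (ensemble n)" and p: "0 \<le> p"
    and le: "\<And>X. measure (coords {..<n}) {x \<in> space (coords {..<n}). X(i := x) \<in> A} \<le> p"
  shows "measure (ensemble n) A \<le> p"
proof -
  have "measure (ensemble n) A \<le> p * measure (ensemble n) (space (ensemble n))"
  proof (rule measure_PiM_le_conditional[where i=i])
    show "A \<subseteq> space (ensemble n)" using A by (rule sets.sets_into_space)
    show "X(i := x) \<in> space (ensemble n) \<longleftrightarrow> X \<in> space (ensemble n)"
      if "X \<in> space (ensemble n)" "x \<in> space (coords {..<n})" for X x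
      using that i unfolding space_PiM[of "{..<n}" "\<lambda>_. coords {..<n}"] by (auto simp: PiE_def extensional_def)
  qed (use i p in \<open>simp_all only: A le prob_space_coords sets.top finite_lessThan lessThan_iff\<close>)
  then show ?thesis by (simp add: prob_space.prob_space[OF prob_space_ensemble])
qed

lemma row_dist2_update: "row_dist2 n (X(i := x)) i = quad_form n (row_proj n X i) x"
  unfolding row_dist2_def by (simp add: row_proj_cong[of i "X(i := x)" X])

lemma row_dist2_small_ball:
  assumes "i < n"
  shows "measure (ensemble n) {X \<in> space (ensemble n). row_dist2 n X i \<le> 1 / (4 * real n)} \<le> (1 - c) ^ (n - i)"
proof (rule measure_ensemble_le_conditional[OF assms])
  interpret R: prob_space "coords {..<n}" by (rule prob_space_coords)
  fix X :: "nat \<Rightarrow> nat \<Rightarrow> real"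
  have "measure (coords {..<n}) {x \<in> space (coords {..<n}). X(i := x) \<in> {X \<in> space (ensemble n). row_dist2 n X i \<le> 1 / (4 * real n)}}
    \<le> measure (coords {..<n}) {x \<in> space (coords {..<n}). quad_form n (row_proj n X i) x \<le> 1 / (4 * real n)}"
    by (intro R.finite_measure_mono) (auto simp: row_dist2_update)
  also have "\<dots> \<le> (1 - c) ^ (n - i)"
    using trace_row_proj[of n i X] assms by (intro quad_form_small_ball is_proj_row_proj) auto
  finally show "measure (coords {..<n}) {x \<in> space (coords {..<n}). X(i := x) \<in> {X \<in> space (ensemble n). row_dist2 n X i \<le> 1 / (4 * real n)}} \<le> (1 - c) ^ (n - i)" .
qed (use assms c_bounds in auto)

lemma row_dist2_lower_tail:
  assumes "i < n"
  shows "measure (ensemble n) {X \<in> space (ensemble n). row_dist2 n X i \<le> (real n - real i) / 2} \<le> 12 * K / (real n - real i)"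
proof (rule measure_ensemble_le_conditional[OF assms])
  interpret R: prob_space "coords {..<n}" by (rule prob_space_coords)
  fix X :: "nat \<Rightarrow> nat \<Rightarrow> real"
  let ?T = "\<Sum>j<n. row_proj n X i j j"
  have T: "real n - real i \<le> ?T" by (rule trace_row_proj)
  have "measure (coords {..<n}) {x \<in> space (coords {..<n}). X(i := x) \<in> {X \<in> space (ensemble n). row_dist2 n X i \<le> (real n - real i) / 2}}
    \<le> measure (coords {..<n}) {x \<in> space (coords {..<n}). quad_form n (row_proj n X i) x \<le> ?T / 2}"
    using T by (intro R.finite_measure_mono) (auto simp: row_dist2_update)
  also have "\<dots> \<le> 12 * K / ?T"
    using T assms by (intro quad_form_lower_tail is_proj_row_proj) auto
  also have "\<dots> \<le> 12 * K / (real n - real i)"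
    using T assms K_ge_1 by (intro divide_left_mono) auto
  finally show "measure (coords {..<n}) {x \<in> space (coords {..<n}). X(i := x) \<in> {X \<in> space (ensemble n). row_dist2 n X i \<le> (real n - real i) / 2}} \<le> 12 * K / (real n - real i)" .
qed (use assms K_ge_1 in auto)

lemma entry_tail: "1 \<le> n \<Longrightarrow> measure \<mu> {y. (real n)\<^sup>2 < \<bar>y\<bar>} \<le> 1 / real n ^ 4"
proof -
  assume n: "1 \<le> n"
  define F where "F = {y::real. (real n)\<^sup>2 < \<bar>y\<bar>}"
  have [simp, measurable]: "F \<in> sets borel" by (simp add: F_def)
  have [simp]: "integrable \<mu> (indicat_real F)"
    by (rule integrable_real_indicator) (auto simp: less_top[symmetric])
  have "real n ^ 4 * prob F = (\<integral>y. real n ^ 4 * indicator F y \<partial>\<mu>)" by simp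
  also have "\<dots> \<le> (\<integral>y. y\<^sup>2 \<partial>\<mu>)"
  proof (rule integral_mono)
    fix y
    have "real n ^ 4 \<le> y\<^sup>2" if "y \<in> F"
    proof -
      have "((real n)\<^sup>2)\<^sup>2 \<le> \<bar>y\<bar>\<^sup>2" using that by (intro power_mono) (auto simp: F_def)
      then show ?thesis by simp
    qed
    then show "real n ^ 4 * indicator F y \<le> y\<^sup>2" by (auto simp: indicator_def)
  qed auto
  finally show ?thesis using n by (simp add: law_second F_def field_simps)
qed

lemma measure_coords_le_conditional:
  assumes j: "j < n" and A: "A \<in> sets (coords {..<n})" and p: "0 \<le> p"
    and le: "\<And>x. measure \<mu> {y. x(j := y) \<in> A} \<le> p"
  shows "measure (coords {..<n}) A \<le> p"
proof -
  have "measure (coords {..<n}) A \<le> p * measure (coords {..<n}) (space (coords {..<n}))"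
  proof (rule measure_PiM_le_conditional[where i=j])
    show "A \<subseteq> space (coords {..<n})" using A by (rule sets.sets_into_space)
    show "x(j := y) \<in> space (coords {..<n}) \<longleftrightarrow> x \<in> space (coords {..<n})"
      if "x \<in> space (coords {..<n})" for x y
      using that j unfolding space_PiM by (auto simp: PiE_def extensional_def)
  qed (use j p A le prob_space_axioms in auto)
  then show ?thesis by (simp add: prob_space.prob_space[OF prob_space_coords])
qed

text \<open>At height n^2 the second moment already gives n^(-4) per entry, which survives the sum
  over n^2 entries.\<close>

lemma unbounded_entries:
  assumes n: "1 \<le> n"
  shows "{X \<in> space (ensemble n). \<exists>l<n. \<exists>k<n. (real n)\<^sup>2 < \<bar>X l k\<bar>} \<in> sets (ensemble n)"
    and "measure (ensemble n) {X \<in> space (ensemble n). \<exists>l<n. \<exists>k<n. (real n)\<^sup>2 < \<bar>X l k\<bar>} \<le> 1 / (real n)\<^sup>2"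
proof -
  interpret Q: prob_space "ensemble n" by (rule prob_space_ensemble)
  let ?E = "\<lambda>(l, k). {X \<in> space (ensemble n). (real n)\<^sup>2 < \<bar>X l k\<bar>}"
  let ?J = "{..<n} \<times> {..<n}"
  have meas: "?E z \<in> sets (ensemble n)" if "z \<in> ?J" for z
    using that by (auto intro!: borel_measurable_less borel_measurable_abs measurable_entry)
  have one: "measure (ensemble n) (?E z) \<le> 1 / real n ^ 4" if z: "z \<in> ?J" for z
  proof -
    obtain l k where lk: "z = (l, k)" "l < n" "k < n" using z by auto
    show ?thesis
    proof (rule measure_ensemble_le_conditional[OF lk(2) meas[OF z]])
      interpret R: prob_space "coords {..<n}" by (rule prob_space_coords)
      fix X :: "nat \<Rightarrow> nat \<Rightarrow> real"
      have "(\<lambda>x. x k) \<in> coords {..<n} \<rightarrow>\<^sub>M \<mu>" using lk by (intro measurable_component_singleton) simp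
      then have "(\<lambda>x. x k) \<in> borel_measurable (coords {..<n})" by (simp cong: measurable_cong_sets)
      then have F: "{x \<in> space (coords {..<n}). (real n)\<^sup>2 < \<bar>x k\<bar>} \<in> sets (coords {..<n})"
        by measurable
      have "measure (coords {..<n}) {x \<in> space (coords {..<n}). X(l := x) \<in> ?E z}
          \<le> measure (coords {..<n}) {x \<in> space (coords {..<n}). (real n)\<^sup>2 < \<bar>x k\<bar>}"
        by (intro R.finite_measure_mono[OF _ F]) (auto simp: lk)
      also have "\<dots> \<le> 1 / real n ^ 4"
      proof (rule measure_coords_le_conditional[OF lk(3)])
        fix x :: "nat \<Rightarrow> real"
        have "measure \<mu> {y. x(k := y) \<in> {x \<in> space (coords {..<n}). (real n)\<^sup>2 < \<bar>x k\<bar>}}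
            \<le> measure \<mu> {y. (real n)\<^sup>2 < \<bar>y\<bar>}"
          by (intro finite_measure_mono) auto
        also have "\<dots> \<le> 1 / real n ^ 4" by (rule entry_tail[OF n])
        finally show "measure \<mu> {y. x(k := y) \<in> {x \<in> space (coords {..<n}). (real n)\<^sup>2 < \<bar>x k\<bar>}} \<le> 1 / real n ^ 4" .
      qed (use F in auto)
      finally show "measure (coords {..<n}) {x \<in> space (coords {..<n}). X(l := x) \<in> ?E z} \<le> 1 / real n ^ 4" .
    qed simp
  qed
  have eq: "{X \<in> space (ensemble n). \<exists>l<n. \<exists>k<n. (real n)\<^sup>2 < \<bar>X l k\<bar>} = (\<Union>z\<in>?J. ?E z)" by auto
  have J: "finite ?J" by simp
  show "{X \<in> space (ensemble n). \<exists>l<n. \<exists>k<n. (real n)\<^sup>2 < \<bar>X l k\<bar>} \<in> sets (ensemble n)"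
    unfolding eq by (rule sets.finite_UN[OF J meas])
  have "measure (ensemble n) {X \<in> space (ensemble n). \<exists>l<n. \<exists>k<n. (real n)\<^sup>2 < \<bar>X l k\<bar>}
      \<le> (\<Sum>z\<in>?J. measure (ensemble n) (?E z))"
    unfolding eq by (rule measure_UNION_le[OF J meas])
  also have "\<dots> \<le> (\<Sum>z\<in>?J. 1 / real n ^ 4)" by (intro sum_mono one)
  also have "\<dots> = 1 / (real n)\<^sup>2" using n by (simp add: power2_eq_square power4_eq_xxxx)
  finally show "measure (ensemble n) {X \<in> space (ensemble n). \<exists>l<n. \<exists>k<n. (real n)\<^sup>2 < \<bar>X l k\<bar>} \<le> 1 / (real n)\<^sup>2" .
qed

lemma sets_nearly_orthogonal:
  assumes i: "i \<le> n"
  shows "{X \<in> space (ensemble n). \<forall>l<i. \<bar>\<Sum>k<n. v k * X l k\<bar> \<le> 1 / 2} \<in> sets (ensemble n)"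
proof -
  have "{X \<in> space (ensemble n). \<bar>\<Sum>k<n. v k * X l k\<bar> \<le> 1 / 2} \<in> sets (ensemble n)" if "l < i" for l
  proof -
    have "(\<lambda>X. \<Sum>k<n. v k * X l k) \<in> borel_measurable (ensemble n)"
      using i that by (intro borel_measurable_sum borel_measurable_times measurable_entry) auto
    then show ?thesis by measurable
  qed
  then have "{X \<in> space (ensemble n). \<forall>l\<in>{..<i}. \<bar>\<Sum>k<n. v k * X l k\<bar> \<le> 1 / 2} \<in> sets (ensemble n)"
    by (intro sets.sets_Collect_finite_All) auto
  then show ?thesis by (simp only: Ball_def lessThan_iff)
qed

text \<open>In each row the coordinate \<open>j\<close>, with coefficient 1, leaves the critical
  interval of length 1 with probability at least \<open>c\<close> given the other coordinates; the
  rows are independent.\<close>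

lemma fixed_vector_nearly_orthogonal:
  assumes j: "j < n" "v j = 1" and i: "i \<le> n"
  shows "measure (ensemble n) {X \<in> space (ensemble n). \<forall>l<i. \<bar>\<Sum>k<n. v k * X l k\<bar> \<le> 1 / 2} \<le> (1 - c) ^ i"
  using i
proof (induction i)
  case 0
  show ?case by (simp add: prob_space.prob_le_1[OF prob_space_ensemble])
next
  case (Suc i)
  let ?A = "\<lambda>i. {X \<in> space (ensemble n). \<forall>l<i. \<bar>\<Sum>k<n. v k * X l k\<bar> \<le> 1 / 2}"
  have meas: "?A i \<in> sets (ensemble n)" if "i \<le> n" for i
    using that by (rule sets_nearly_orthogonal)
  have row: "measure (coords {..<n}) {x \<in> space (coords {..<n}). \<bar>\<Sum>k<n. v k * x k\<bar> \<le> 1 / 2} \<le> 1 - c"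
  proof (rule measure_coords_le_conditional[OF j(1)])
    fix x :: "nat \<Rightarrow> real"
    define s where "s = (\<Sum>k\<in>{..<n}-{j}. v k * x k)"
    have s: "(\<Sum>k<n. v k * (x(j := y)) k) = y + s" for y
      unfolding s_def using j by (subst sum.remove[of _ j]) (auto intro!: sum.cong)
    have "measure \<mu> {y. x(j := y) \<in> {x \<in> space (coords {..<n}). \<bar>\<Sum>k<n. v k * x k\<bar> \<le> 1 / 2}}
        \<le> measure \<mu> {y. \<bar>y - (- s)\<bar> \<le> 1 / 2}"
      by (intro finite_measure_mono) (auto simp: s simp del: fun_upd_apply)
    also have "\<dots> \<le> 1 - c" by (rule small_ball)
    finally show "measure \<mu> {y. x(j := y) \<in> {x \<in> space (coords {..<n}). \<bar>\<Sum>k<n. v k * x k\<bar> \<le> 1 / 2}} \<le> 1 - c" .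
  qed (use c_bounds in auto)
  have "measure (ensemble n) (?A (Suc i)) \<le> (1 - c) * measure (ensemble n) (?A i)"
  proof (rule measure_PiM_le_conditional[where i=i])
    show "?A (Suc i) \<subseteq> ?A i" by auto
    show "X(i := x) \<in> ?A i \<longleftrightarrow> X \<in> ?A i"
      if "X \<in> space (ensemble n)" "x \<in> space (coords {..<n})" for X x
    proof -
      have "X(i := x) \<in> space (ensemble n)"
        using that Suc.prems unfolding space_PiM[of "{..<n}" "\<lambda>_. coords {..<n}"]
        by (auto simp: PiE_def extensional_def)
      then show ?thesis using that(1) by simp
    qed
    show "measure (coords {..<n}) {x \<in> space (coords {..<n}). X(i := x) \<in> ?A (Suc i)} \<le> 1 - c" for X
    proof -
      interpret R: prob_space "coords {..<n}" by (rule prob_space_coords)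
      have "measure (coords {..<n}) {x \<in> space (coords {..<n}). X(i := x) \<in> ?A (Suc i)}
          \<le> measure (coords {..<n}) {x \<in> space (coords {..<n}). \<bar>\<Sum>k<n. v k * x k\<bar> \<le> 1 / 2}"
        by (intro R.finite_measure_mono) (auto dest: spec[of _ i])
      then show ?thesis using row by linarith
    qed
  qed (use Suc.prems c_bounds in \<open>simp_all only: meas prob_space_coords finite_lessThan lessThan_iff
      Suc_le_eq less_imp_le diff_ge_0_iff_ge\<close>)
  also have "\<dots> \<le> (1 - c) * (1 - c) ^ i"
    using c_bounds Suc by (intro mult_left_mono) auto
  finally show ?case by simp
qed

lemma nearly_orthogonal_sparse_probability:
  assumes i: "i \<le> n"
  shows "{X \<in> space (ensemble n). nearly_orthogonal_sparse n m X i} \<in> sets (ensemble n)"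
    and "measure (ensemble n) {X \<in> space (ensemble n). nearly_orthogonal_sparse n m X i}
      \<le> (real n * (4 * real n ^ 4 + 1)) ^ m * (1 - c) ^ i"
proof -
  interpret Q: prob_space "ensemble n" by (rule prob_space_ensemble)
  let ?E = "\<lambda>xs. {X \<in> space (ensemble n). \<forall>l<i. \<bar>\<Sum>k<n. grid_vec (2 * n ^ 3) xs k * X l k\<bar> \<le> 1 / 2}"
  have meas: "?E xs \<in> sets (ensemble n)" for xs
    using i by (rule sets_nearly_orthogonal)
  have eq: "{X \<in> space (ensemble n). nearly_orthogonal_sparse n m X i} = (\<Union>xs\<in>sparse_grid n m. ?E xs)"
    by (auto simp: nearly_orthogonal_sparse_def)
  show "{X \<in> space (ensemble n). nearly_orthogonal_sparse n m X i} \<in> sets (ensemble n)"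
    unfolding eq by (rule sets.finite_UN[OF finite_sparse_grid meas])
  have "measure (ensemble n) (\<Union>xs\<in>sparse_grid n m. ?E xs) \<le> (\<Sum>xs\<in>sparse_grid n m. measure (ensemble n) (?E xs))"
    by (rule measure_UNION_le[OF finite_sparse_grid meas])
  also have "\<dots> \<le> (\<Sum>xs\<in>sparse_grid n m. (1 - c) ^ i)"
  proof (rule sum_mono)
    fix xs assume "xs \<in> sparse_grid n m"
    then obtain j where "j < n" "grid_vec (2 * n ^ 3) xs j = 1" unfolding sparse_grid_def by blast
    then show "measure (ensemble n) (?E xs) \<le> (1 - c) ^ i" using i by (rule fixed_vector_nearly_orthogonal)
  qed
  also have "\<dots> = real (card (sparse_grid n m)) * (1 - c) ^ i" by simp
  also have "\<dots> \<le> real ((n * (4 * n ^ 4 + 1)) ^ m) * (1 - c) ^ i"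
    using c_bounds card_sparse_grid by (intro mult_right_mono of_nat_mono) auto
  also have "\<dots> = (real n * (4 * real n ^ 4 + 1)) ^ m * (1 - c) ^ i"
    by (simp add: algebra_simps)
  finally show "measure (ensemble n) {X \<in> space (ensemble n). nearly_orthogonal_sparse n m X i}
      \<le> (real n * (4 * real n ^ 4 + 1)) ^ m * (1 - c) ^ i"
    unfolding eq .
qed

lemma sets_row_dist2_le: "i < n \<Longrightarrow> {X \<in> space (ensemble n). row_dist2 n X i \<le> t} \<in> sets (ensemble n)"
  by measurable

text \<open>Outside the two removed events the earlier rows admit a spread normal vector
  \<open>w\<close>. It is fixed when row \<open>i\<close> is resampled, and a small distance forces
  the linear form of row \<open>i\<close> with coefficients \<open>w\<close> to be small.\<close>

lemma last_row_dist2_small_ball: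
  assumes i: "i < n" and m: "m \<le> n" and N: "1 \<le> N"
  defines "A \<equiv> {X \<in> space (ensemble n). row_dist2 n X i \<le> 1 / (256 * real n ^ 8)}
      - {X \<in> space (ensemble n). \<exists>l<n. \<exists>k<n. (real n)\<^sup>2 < \<bar>X l k\<bar>}
      - {X \<in> space (ensemble n). nearly_orthogonal_sparse n m X i}"
  shows "A \<in> sets (ensemble n)" and "measure (ensemble n) A \<le> 1 / real N + real N / (c * (m + 1))"
proof -
  have n: "0 < real n" using i by simp
  have n1: "1 \<le> n" using i by simp
  show A: "A \<in> sets (ensemble n)"
    unfolding A_def
    by (intro sets.Diff sets_row_dist2_le[OF i] unbounded_entries(1)[OF n1]
        nearly_orthogonal_sparse_probability(1)[OF less_imp_le[OF i]])
  show "measure (ensemble n) A \<le> 1 / real N + real N / (c * (m + 1))"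
  proof (rule measure_ensemble_le_conditional[OF i A])
    interpret R: prob_space "coords {..<n}" by (rule prob_space_coords)
    show nonneg: "0 \<le> 1 / real N + real N / (c * (m + 1))" using c_bounds by simp
    fix X :: "nat \<Rightarrow> nat \<Rightarrow> real"
    let ?B = "{x \<in> space (coords {..<n}). X(i := x) \<in> A}"
    \<comment> \<open>Only the rows before \<open>i\<close> enter this event, so resampling row
      \<open>i\<close> leaves it unchanged.\<close>
    have nos: "nearly_orthogonal_sparse n m (X(i := x)) i \<longleftrightarrow> nearly_orthogonal_sparse n m X i" for x
      unfolding nearly_orthogonal_sparse_def by simp
    show "measure (coords {..<n}) ?B \<le> 1 / real N + real N / (c * (m + 1))"
    proof (cases "(\<forall>l<i. \<forall>k<n. \<bar>X l k\<bar> \<le> (real n)\<^sup>2) \<and> \<not> nearly_orthogonal_sparse n m X i")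
      case True
      define a where "a = 1 / (2 * real n ^ 3)"
      have a: "0 < a" using n by (simp add: a_def)
      obtain w where w: "m \<le> card {k \<in> {..<n}. a \<le> \<bar>w k\<bar>}"
        "\<And>x. (\<Sum>k<n. w k * x k)\<^sup>2 \<le> (real n)\<^sup>2 * quad_form n (row_proj n X i) x"
        using spread_normal_vector[OF i m, of X] True unfolding a_def by blast
      have "measure (coords {..<n}) ?B \<le> measure (coords {..<n}) {x \<in> space (coords {..<n}). \<bar>\<Sum>k<n. w k * x k\<bar> \<le> a / 8}"
      proof (rule R.finite_measure_mono)
        show "?B \<subseteq> {x \<in> space (coords {..<n}). \<bar>\<Sum>k<n. w k * x k\<bar> \<le> a / 8}"
        proof (intro subsetI CollectI conjI)
          fix x assume x: "x \<in> ?B"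
          then show "x \<in> space (coords {..<n})" by blast
          from x have q: "quad_form n (row_proj n X i) x \<le> 1 / (256 * real n ^ 8)"
            unfolding A_def by (simp add: row_dist2_update)
          have "(\<Sum>k<n. w k * x k)\<^sup>2 \<le> (real n)\<^sup>2 * (1 / (256 * real n ^ 8))"
            using w(2)[of x] mult_left_mono[OF q, of "(real n)\<^sup>2"] by simp
          \<comment> \<open>The origin of the threshold 1/(256 n^8): multiplied by n^2 it is the
            square of a/8 = 1/(16 n^3).\<close>
          also have "\<dots> = (a / 8)\<^sup>2"
            using n by (simp add: a_def power_divide power_mult_distrib flip: power_mult) (simp add: field_simps flip: power_add)
          finally show "\<bar>\<Sum>k<n. w k * x k\<bar> \<le> a / 8"
            using a by (intro power2_le_imp_le[of "\<bar>_\<bar>"]) auto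
        qed
      qed measurable
      also have "\<dots> \<le> 1 / real N + real N / (c * (m + 1))"
        by (rule linear_form_abs_small_ball[OF _ a N w(1)]) simp
      finally show ?thesis .
    next
      case False
      have "?B = {}"
      proof (rule equals0I)
        fix x assume "x \<in> ?B"
        then have "\<not> (\<exists>l<n. \<exists>k<n. (real n)\<^sup>2 < \<bar>(X(i := x)) l k\<bar>)" "\<not> nearly_orthogonal_sparse n m X i"
          unfolding A_def nos[of x, symmetric] by auto
        then have "\<bar>X l k\<bar> \<le> (real n)\<^sup>2" if "l < i" "k < n" for l k
          using that i by (metis fun_upd_other less_irrefl less_trans not_less)
        then show False using False \<open>\<not> nearly_orthogonal_sparse n m X i\<close> by blast
      qed
      then show ?thesis using nonneg by (simp only: measure_empty)
    qed
  qed
qed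

section \<open>All factors are polynomially bounded below with high probability\<close>

lemma sparse_bound_tendsto_0:
  "(\<lambda>n. (real n * (4 * real n ^ 4 + 1)) ^ m * (1 - c) ^ (n div 2)) \<longlonglongrightarrow> 0"
proof (rule tendsto_sandwich[OF _ _ tendsto_const])
  let ?C = "5 ^ m * (2 / c) ^ (5 * m) * exp (c / 2)"
  let ?x = "\<lambda>n. c * real n / 2"
  show "\<forall>\<^sub>F n in sequentially. 0 \<le> (real n * (4 * real n ^ 4 + 1)) ^ m * (1 - c) ^ (n div 2)"
    using c_bounds by (intro always_eventually allI mult_nonneg_nonneg zero_le_power) auto
  have "filterlim ?x at_top sequentially"
    using c_bounds by real_asymp
  then have "(\<lambda>n. ?x n ^ (5 * m) / exp (?x n)) \<longlonglongrightarrow> 0"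
    by (rule filterlim_compose[OF tendsto_power_div_exp_0])
  then show "(\<lambda>n. ?C * (?x n ^ (5 * m) / exp (?x n))) \<longlonglongrightarrow> 0"
    by (rule tendsto_mult_right_zero)
  show "\<forall>\<^sub>F n in sequentially. (real n * (4 * real n ^ 4 + 1)) ^ m * (1 - c) ^ (n div 2) \<le> ?C * (?x n ^ (5 * m) / exp (?x n))"
  proof (rule eventually_sequentiallyI[of 1])
    fix n :: nat assume n: "1 \<le> n"
    have "4 * real n ^ 4 + 1 \<le> 5 * real n ^ 4" using one_le_power[of "real n" 4] n by simp
    then have "real n * (4 * real n ^ 4 + 1) \<le> real n * (5 * real n ^ 4)" by (intro mult_left_mono) auto
    also have "\<dots> = 5 * real n ^ 5" by (simp add: eval_nat_numeral)
    finally have "(real n * (4 * real n ^ 4 + 1)) ^ m \<le> (5 * real n ^ 5) ^ m"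
      by (intro power_mono) auto
    also have "\<dots> = 5 ^ m * (2 / c) ^ (5 * m) * ?x n ^ (5 * m)"
    proof -
      have "real n = 2 / c * ?x n" using c_bounds by simp
      then have "real n ^ (5 * m) = (2 / c) ^ (5 * m) * ?x n ^ (5 * m)"
        by (metis power_mult_distrib)
      moreover have "(5 * real n ^ 5) ^ m = 5 ^ m * real n ^ (5 * m)"
        by (simp only: power_mult_distrib power_mult)
      ultimately show ?thesis by simp
    qed
    finally have 1: "(real n * (4 * real n ^ 4 + 1)) ^ m \<le> 5 ^ m * (2 / c) ^ (5 * m) * ?x n ^ (5 * m)" .
    have "(1 - c) ^ (n div 2) \<le> exp (- c) ^ (n div 2)"
      using c_bounds exp_ge_add_one_self[of "- c"] by (intro power_mono) auto
    also have "\<dots> = exp (- c * real (n div 2))" by (simp add: exp_of_nat_mult[symmetric] mult.commute)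
    \<comment> \<open>The factor exp (c / 2) pays for the rounding in
      \<open>n div 2\<close>.\<close>
    also have "\<dots> \<le> exp (c / 2 - ?x n)"
    proof -
      have "real n / 2 - 1 / 2 \<le> real (n div 2)" by linarith
      then have "c * (real n / 2 - 1 / 2) \<le> c * real (n div 2)" using c_bounds by (intro mult_left_mono) auto
      then show ?thesis by (simp add: algebra_simps)
    qed
    also have "\<dots> = exp (c / 2) / exp (?x n)" by (rule exp_diff)
    finally have 2: "(1 - c) ^ (n div 2) \<le> exp (c / 2) / exp (?x n)" .
    show "(real n * (4 * real n ^ 4 + 1)) ^ m * (1 - c) ^ (n div 2) \<le> ?C * (?x n ^ (5 * m) / exp (?x n))"
      using mult_mono[OF 1 2] c_bounds by (simp add: mult_ac)
  qed
qed

text \<open>The bound is independent of n, and this is why all but a bounded number of rows can be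
  treated by elimination.\<close>

lemma geometric_tail: "(\<Sum>i<n - k. (1 - c) ^ (n - i)) \<le> (1 - c) ^ k / c"
proof (cases "k \<le> n")
  case True
  define q where "q = 1 - c"
  have q: "0 \<le> q" "q < 1" using c_bounds by (auto simp: q_def)
  let ?M = "n - k"
  have "(\<Sum>i<?M. q ^ (n - i)) \<le> (\<Sum>i<?M. q ^ k * q ^ (?M - Suc i))"
    using q True by (intro sum_mono) (auto simp: power_add[symmetric] intro!: power_decreasing)
  also have "\<dots> = q ^ k * (\<Sum>i<?M. q ^ i)"
    unfolding sum_distrib_left[symmetric] by (subst sum.nat_diff_reindex) (rule refl)
  also have "(\<Sum>i<?M. q ^ i) = (1 - q ^ ?M) / (1 - q)"
    using q by (simp add: sum_gp_strict)
  also have "q ^ k * ((1 - q ^ ?M) / (1 - q)) \<le> q ^ k * (1 / (1 - q))"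
    using q by (intro mult_left_mono divide_right_mono) auto
  finally show ?thesis by (simp add: q_def)
qed (use c_bounds in simp)

lemma all_row_dist2_lower_bound:
  assumes \<eta>: "0 < \<eta>"
  shows "\<forall>\<^sub>F n in sequentially.
    measure (ensemble n) {X \<in> space (ensemble n). \<exists>i<n. row_dist2 n X i \<le> 1 / (256 * real n ^ 8)} \<le> \<eta>"
proof -
  \<comment> \<open>The order of choices matters: \<open>k\<close> makes the geometric tail small,
    \<open>N\<close> then makes k/N small, \<open>m\<close> finally dominates k N. All three are
    fixed before n grows, so the size of the grid is polynomial of fixed degree.\<close>
  have "(\<lambda>k. (1 - c) ^ k / c) \<longlonglongrightarrow> 0"
    using c_bounds by (intro tendsto_divide_zero LIMSEQ_realpow_zero) auto
  from order_tendstoD(2)[OF this, of "\<eta> / 4"] obtain k where k: "(1 - c) ^ k / c < \<eta> / 4"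
    using \<eta> by (auto simp: eventually_sequentially)
  obtain N0 :: nat where N0: "8 * real k / \<eta> < real N0" using reals_Archimedean2 by blast
  define N where "N = Suc N0"
  have N: "1 \<le> N" "real k * (1 / real N) \<le> \<eta> / 8"
    using N0 \<eta> by (auto simp: N_def field_simps)
  obtain m :: nat where m: "8 * (real k * real N) / (c * \<eta>) < real m" using reals_Archimedean2 by blast
  have m': "real k * (real N / (c * (m + 1))) \<le> \<eta> / 8"
  proof -
    have "8 * (real k * real N) < real m * (c * \<eta>)"
      using m \<eta> c_bounds by (simp add: pos_divide_less_eq)
    also have "\<dots> \<le> (real m + 1) * (c * \<eta>)"
      using \<eta> c_bounds by (intro mult_right_mono) auto
    finally have "real k * real N \<le> \<eta> / 8 * (c * (m + 1))" by (simp add: algebra_simps)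
    then have "real k * real N / (c * (m + 1)) \<le> \<eta> / 8"
      using c_bounds by (subst pos_divide_le_eq) auto
    then show ?thesis by simp
  qed
  have ev1: "\<forall>\<^sub>F n in sequentially. 1 / (real n)\<^sup>2 < \<eta> / 4"
  proof -
    have "(\<lambda>n. 1 / (real n)\<^sup>2) \<longlonglongrightarrow> 0" by real_asymp
    then show ?thesis using \<eta> by (intro order_tendstoD(2)) auto
  qed
  have ev2: "\<forall>\<^sub>F n in sequentially. (real n * (4 * real n ^ 4 + 1)) ^ m * (1 - c) ^ (n div 2) < \<eta> / 4"
    using \<eta> by (intro order_tendstoD(2)[OF sparse_bound_tendsto_0]) auto
  show ?thesis
    using ev1 ev2 eventually_ge_at_top[of "max 1 (max m (2 * k))"]
  proof eventually_elim
    case (elim n)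
    then have n: "1 \<le> n" "m \<le> n" "2 * k \<le> n" by auto
    interpret Q: prob_space "ensemble n" by (rule prob_space_ensemble)
    \<comment> \<open>Each of the four exceptional events gets \<open>\<eta> / 4\<close>: an
      oversized entry, a sparse vector nearly orthogonal to the first \<open>n div 2\<close> rows, a
      small factor before the last \<open>k\<close> rows, and a small factor among them. Since
      \<open>2 * k \<le> n\<close>, the last rows have index at least \<open>n div 2\<close>, and
      antimonotonicity lets the single event \<open>V\<close> serve them all.\<close>
    define U where "U = {X \<in> space (ensemble n). \<exists>l<n. \<exists>k<n. (real n)\<^sup>2 < \<bar>X l k\<bar>}"
    define V where "V = {X \<in> space (ensemble n). nearly_orthogonal_sparse n m X (n div 2)}"
    define W where "W = (\<Union>i<n - k. {X \<in> space (ensemble n). row_dist2 n X i \<le> 1 / (4 * real n)})"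
    define A where "A i = {X \<in> space (ensemble n). row_dist2 n X i \<le> 1 / (256 * real n ^ 8)}
      - {X \<in> space (ensemble n). \<exists>l<n. \<exists>k<n. (real n)\<^sup>2 < \<bar>X l k\<bar>}
      - {X \<in> space (ensemble n). nearly_orthogonal_sparse n m X i}" for i
    define Z where "Z = (\<Union>i\<in>{n - k..<n}. A i)"
    note U = unbounded_entries[OF n(1), folded U_def]
    have "n div 2 \<le> n" by simp
    note V = nearly_orthogonal_sparse_probability[OF this, of m, folded V_def]
    have W1: "W \<in> sets (ensemble n)"
      unfolding W_def by (intro sets.finite_UN sets_row_dist2_le) auto
    have "Q.prob W \<le> (\<Sum>i<n - k. Q.prob {X \<in> space (ensemble n). row_dist2 n X i \<le> 1 / (4 * real n)})"
      unfolding W_def by (intro measure_UNION_le sets_row_dist2_le) auto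
    also have "\<dots> \<le> (\<Sum>i<n - k. (1 - c) ^ (n - i))"
      by (intro sum_mono row_dist2_small_ball) auto
    also have "\<dots> \<le> \<eta> / 4" using geometric_tail[of n k] k by linarith
    finally have W2: "Q.prob W \<le> \<eta> / 4" .
    have A: "A i \<in> sets (ensemble n)" "Q.prob (A i) \<le> 1 / real N + real N / (c * (m + 1))" if "i < n" for i
      unfolding A_def by (rule last_row_dist2_small_ball[OF that n(2) N(1)])+
    have Z1: "Z \<in> sets (ensemble n)"
      unfolding Z_def by (intro sets.finite_UN A) auto
    have "Q.prob Z \<le> (\<Sum>i\<in>{n - k..<n}. Q.prob (A i))"
      unfolding Z_def by (intro measure_UNION_le A) auto
    also have "\<dots> \<le> (\<Sum>i\<in>{n - k..<n}. 1 / real N + real N / (c * (m + 1)))"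
      by (intro sum_mono A) auto
    also have "\<dots> = real k * (1 / real N + real N / (c * (m + 1)))" using n by simp
    also have "\<dots> \<le> \<eta> / 4" unfolding distrib_left using N(2) m' by linarith
    finally have Z2: "Q.prob Z \<le> \<eta> / 4" .
    have "Q.prob {X \<in> space (ensemble n). \<exists>i<n. row_dist2 n X i \<le> 1 / (256 * real n ^ 8)}
        \<le> Q.prob (U \<union> (V \<union> (W \<union> Z)))"
    proof (rule Q.finite_measure_mono)
      show "{X \<in> space (ensemble n). \<exists>i<n. row_dist2 n X i \<le> 1 / (256 * real n ^ 8)} \<subseteq> U \<union> (V \<union> (W \<union> Z))"
      proof safe
        fix X i assume X: "X \<in> space (ensemble n)" "i < n" "row_dist2 n X i \<le> 1 / (256 * real n ^ 8)"
          "X \<notin> U" "X \<notin> V" "X \<notin> Z"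
        have "i < n - k"
        proof (rule ccontr)
          assume "\<not> i < n - k"
          then have i: "i \<in> {n - k..<n}" "n div 2 \<le> i" using X n by auto
          have "\<not> nearly_orthogonal_sparse n m X i"
            using X nearly_orthogonal_sparse_antimono[OF _ i(2)] unfolding V_def by blast
          then have "X \<in> A i" using X unfolding A_def U_def by blast
          then show False using X i unfolding Z_def by blast
        qed
        moreover have "1 / (256 * real n ^ 8) \<le> 1 / (4 * real n)"
        proof (rule divide_left_mono)
          have "real n \<le> real n ^ 8" using n by (intro self_le_power) auto
          then show "4 * real n \<le> 256 * real n ^ 8" by linarith
        qed (use n in auto)
        ultimately show "X \<in> W" using X unfolding W_def by (auto intro: order_trans)
      qed
      show "U \<union> (V \<union> (W \<union> Z)) \<in> sets (ensemble n)"
        by (intro sets.Un U(1) V(1) W1 Z1)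
    qed
    also have "\<dots> \<le> Q.prob U + (Q.prob V + (Q.prob W + Q.prob Z))"
      by (intro order_trans[OF measure_Un_le] add_left_mono measure_Un_le sets.Un U(1) V(1) W1 Z1)
    also have "\<dots> \<le> \<eta>" using U(2) V(2) W2 Z2 elim(1,2) by linarith
    finally show ?case .
  qed
qed

end

section \<open>The determinant\<close>

text \<open>Taking logarithms, the two kinds of loss are at most
  \<open>\<epsilon> * n * ln n\<close> each: one from the constant 40/\<epsilon> in the typical
  factors, one from the few factors in \<open>T\<close>.\<close>

lemma prod_lower_bound_few_small:
  fixes \<rho> :: "nat \<Rightarrow> real"
  assumes \<epsilon>: "0 < \<epsilon>" "\<epsilon> \<le> 1" and n: "256 \<le> n"
    and ln: "ln (40 / \<epsilon>) \<le> \<epsilon> * ln (real n)"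
    and all: "\<And>i. i < n \<Longrightarrow> 1 / (256 * real n ^ 8) < \<rho> i"
    and few: "real (card {i \<in> {..<n}. \<rho> i \<le> \<epsilon> / 20 * real n / 2}) \<le> \<epsilon> / 10 * real n"
  shows "real n powr ((1 - 2 * \<epsilon>) * real n) \<le> (\<Prod>i<n. \<rho> i)"
proof -
  define T where "T = {i \<in> {..<n}. \<rho> i \<le> \<epsilon> / 20 * real n / 2}"
  have n0: "0 < real n" and lnn: "0 \<le> ln (real n)" using n by auto
  have pos: "0 < \<rho> i" if "i < n" for i
    by (rule less_trans[OF _ all[OF that]]) (use n0 in simp)
  have ne: "\<rho> i \<noteq> 0" if "i < n" for i using pos[OF that] by simp
  \<comment> \<open>For n >= 256 a factor in \<open>T\<close> still exceeds n^(-9), so compared with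
    a factor of order n it loses at most n^10; hence the weight 10, matching the proportion
    \<open>\<epsilon> / 10\<close> in \<open>few\<close>.\<close>
  have each: "- ln (40 / \<epsilon>) + ln (real n) - 10 * ln (real n) * (if i \<in> T then 1 else 0) \<le> ln (\<rho> i)"
    if "i < n" for i
  proof (cases "i \<in> T")
    case True
    have "0 \<le> ln (40 / \<epsilon>)" using \<epsilon> by simp
    moreover have "- 9 * ln (real n) \<le> ln (\<rho> i)"
    proof -
      have "1 / real n ^ 9 \<le> 1 / (256 * real n ^ 8)"
      proof (rule divide_left_mono)
        have "256 * real n ^ 8 \<le> real n * real n ^ 8" using n by (intro mult_right_mono) auto
        then show "256 * real n ^ 8 \<le> real n ^ 9" by (simp add: eval_nat_numeral)
      qed (use n0 in auto)
      then have "ln (1 / real n ^ 9) \<le> ln (\<rho> i)"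
        using all[OF that] n0 pos[OF that] by (subst ln_le_cancel_iff) auto
      then show ?thesis using n0 by (simp add: ln_div ln_realpow)
    qed
    ultimately show ?thesis using True by simp
  next
    case False
    then have "\<epsilon> / 40 * real n \<le> \<rho> i" using that by (simp add: T_def)
    then have "ln (\<epsilon> / 40 * real n) \<le> ln (\<rho> i)"
      using \<epsilon> n0 pos[OF that] by (subst ln_le_cancel_iff) auto
    also have "ln (\<epsilon> / 40 * real n) = - ln (40 / \<epsilon>) + ln (real n)"
      using \<epsilon> n0 by (simp add: ln_mult ln_div)
    finally show ?thesis using False by simp
  qed
  have "(\<Sum>i<n. if i \<in> T then 1 else 0) = real (card T)"
    by (simp add: T_def sum.If_cases Int_def)
  then have "real n * (- ln (40 / \<epsilon>) + ln (real n)) - 10 * ln (real n) * real (card T) =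
      (\<Sum>i<n. - ln (40 / \<epsilon>) + ln (real n) - 10 * ln (real n) * (if i \<in> T then 1 else 0))"
    unfolding sum_subtractf sum_distrib_left[symmetric] by simp
  also have "\<dots> \<le> (\<Sum>i<n. ln (\<rho> i))" by (intro sum_mono each) simp
  also have "\<dots> = ln (\<Prod>i<n. \<rho> i)" by (subst ln_prod) (auto simp: ne)
  finally have 1: "real n * (- ln (40 / \<epsilon>) + ln (real n)) - 10 * ln (real n) * real (card T) \<le> ln (\<Prod>i<n. \<rho> i)" .
  have "real n * ln (40 / \<epsilon>) \<le> real n * (\<epsilon> * ln (real n))" by (intro mult_left_mono ln) simp
  moreover have "10 * ln (real n) * real (card T) \<le> 10 * ln (real n) * (\<epsilon> / 10 * real n)"
    using few lnn unfolding T_def by (intro mult_left_mono) auto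
  ultimately have "(1 - 2 * \<epsilon>) * real n * ln (real n) \<le> ln (\<Prod>i<n. \<rho> i)"
    using 1 by (simp add: algebra_simps)
  then have "exp ((1 - 2 * \<epsilon>) * real n * ln (real n)) \<le> (\<Prod>i<n. \<rho> i)"
    using pos by (subst ln_ge_iff[symmetric]) (auto intro!: prod_pos)
  then show ?thesis using n0 by (simp add: powr_def)
qed

lemma card_last_indices:
  assumes "0 \<le> t"
  shows "real (card {i \<in> {..<n}. real n - real i < t}) \<le> t"
proof -
  have "{i \<in> {..<n}. real n - real i < t} \<subseteq> {n - nat \<lfloor>t\<rfloor>..<n}"
  proof safe
    fix i assume i: "i < n" "real n - real i < t"
    then have "real (n - i) < t" by simp
    then have "int (n - i) \<le> \<lfloor>t\<rfloor>" by linarith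
    then show "i \<in> {n - nat \<lfloor>t\<rfloor>..<n}" using i by auto
  qed
  then have "card {i \<in> {..<n}. real n - real i < t} \<le> card {n - nat \<lfloor>t\<rfloor>..<n}"
    by (intro card_mono) auto
  also have "\<dots> \<le> nat \<lfloor>t\<rfloor>" by simp
  finally have "real (card {i \<in> {..<n}. real n - real i < t}) \<le> real (nat \<lfloor>t\<rfloor>)" by (rule of_nat_mono)
  also have "\<dots> \<le> t" using assms by linarith
  finally show ?thesis .
qed

context entry_law
begin

text \<open>Markov's inequality for the number of bad rows, which asks nothing of their joint law.
  Keeping n - i at least \<open>\<delta> * n\<close> makes each row bad with probability O(1/n), so
  the expected number of bad rows is bounded in n.\<close>

lemma many_small_rows:
  assumes \<delta>: "0 < \<delta>" and n: "1 \<le> n"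
  defines "A \<equiv> {X \<in> space (ensemble n). \<delta> * real n \<le>
      (\<Sum>i\<in>{i\<in>{..<n}. \<delta> * real n \<le> real n - real i}. indicat_real {X \<in> space (ensemble n). row_dist2 n X i \<le> \<delta> * real n / 2} X)}"
  shows "A \<in> sets (ensemble n)" and "measure (ensemble n) A \<le> 12 * K / (\<delta>\<^sup>2 * real n)"
proof -
  interpret Q: prob_space "ensemble n" by (rule prob_space_ensemble)
  define J where "J = {i\<in>{..<n}. \<delta> * real n \<le> real n - real i}"
  define E where "E i = {X \<in> space (ensemble n). row_dist2 n X i \<le> \<delta> * real n / 2}" for i
  have J: "finite J" "card J \<le> n" "\<And>i. i \<in> J \<Longrightarrow> i < n"
    using card_mono[of "{..<n}" J] by (auto simp: J_def)
  have E: "E i \<in> sets (ensemble n)" if "i \<in> J" for i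
    unfolding E_def by (rule sets_row_dist2_le[OF J(3)[OF that]])
  have u: "integrable (ensemble n) (indicat_real (E i))" if "i \<in> J" for i
    using E[OF that] by (intro integrable_real_indicator) (simp_all add: Q.emeasure_eq_measure)
  have U: "integrable (ensemble n) (\<lambda>X. \<Sum>i\<in>J. indicat_real (E i) X)"
    by (intro Bochner_Integration.integrable_sum u)
  have A: "A = {X \<in> space (ensemble n). \<delta> * real n \<le> (\<Sum>i\<in>J. indicat_real (E i) X)}"
    unfolding A_def J_def E_def ..
  have [measurable]: "(\<lambda>X. \<Sum>i\<in>J. indicat_real (E i) X) \<in> borel_measurable (ensemble n)"
    using U by (rule borel_measurable_integrable)
  show "A \<in> sets (ensemble n)" unfolding A by measurable
  have dn: "0 < \<delta> * real n" using \<delta> n by simp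
  have P: "Q.prob (E i) \<le> 12 * K / (\<delta> * real n)" if "i \<in> J" for i
  proof -
    have i: "i < n" "\<delta> * real n \<le> real n - real i" using that by (auto simp: J_def)
    have "Q.prob (E i) \<le> Q.prob {X \<in> space (ensemble n). row_dist2 n X i \<le> (real n - real i) / 2}"
      by (rule Q.finite_measure_mono[OF _ sets_row_dist2_le[OF i(1)]]) (use i in \<open>auto simp: E_def\<close>)
    also have "\<dots> \<le> 12 * K / (real n - real i)" by (rule row_dist2_lower_tail[OF i(1)])
    also have "\<dots> \<le> 12 * K / (\<delta> * real n)"
      using i dn K_ge_1 by (intro divide_left_mono) auto
    finally show ?thesis .
  qed
  have "Q.prob A \<le> (\<integral>X. (\<Sum>i\<in>J. indicat_real (E i) X) \<partial>ensemble n) / (\<delta> * real n)"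
    unfolding A by (rule integral_Markov_inequality_measure[OF U sets.empty_sets]) (auto intro!: sum_nonneg dn)
  also have "(\<integral>X. (\<Sum>i\<in>J. indicat_real (E i) X) \<partial>ensemble n) = (\<Sum>i\<in>J. Q.prob (E i))"
    using E u by (subst Bochner_Integration.integral_sum) auto
  also have "\<dots> \<le> (\<Sum>i\<in>J. 12 * K / (\<delta> * real n))" by (intro sum_mono P)
  also have "\<dots> \<le> real n * (12 * K / (\<delta> * real n))"
    unfolding sum_constant using J(2) K_ge_1 dn by (intro mult_right_mono) auto
  finally have "Q.prob A \<le> real n * (12 * K / (\<delta> * real n)) / (\<delta> * real n)"
    using dn by (simp add: divide_right_mono)
  then show "measure (ensemble n) A \<le> 12 * K / (\<delta>\<^sup>2 * real n)"
    using n \<delta> by (simp add: power2_eq_square mult_ac)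
qed

lemma prod_row_dist2_lower_bound:
  assumes \<epsilon>: "0 < \<epsilon>" "\<epsilon> \<le> 1" and \<eta>: "0 < \<eta>"
  shows "\<forall>\<^sub>F n in sequentially. 1 - \<eta> \<le> measure (ensemble n)
    {X \<in> space (ensemble n). real n powr ((1 - 2 * \<epsilon>) * real n) \<le> (\<Prod>i<n. row_dist2 n X i)}"
proof -
  \<comment> \<open>Small factors come from two sources with at most \<open>\<delta> * n\<close>
    each: the last rows with n - i below \<open>\<delta> * n\<close>, and the bad ones among the
    others. Together they fit into \<open>\<epsilon> / 10 * n\<close>.\<close>
  define \<delta> where "\<delta> = \<epsilon> / 20"
  have \<delta>: "0 < \<delta>" using \<epsilon> by (simp add: \<delta>_def)
  have "(\<lambda>n. 12 * K / (\<delta>\<^sup>2 * real n)) \<longlonglongrightarrow> 0"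
    using \<delta> by real_asymp
  then have ev1: "\<forall>\<^sub>F n in sequentially. 12 * K / (\<delta>\<^sup>2 * real n) < \<eta> / 2"
    using \<eta> by (intro order_tendstoD(2)) auto
  have "filterlim (\<lambda>n. \<epsilon> * ln (real n)) at_top sequentially"
    using \<epsilon> by real_asymp
  then have ev2: "\<forall>\<^sub>F n in sequentially. ln (40 / \<epsilon>) \<le> \<epsilon> * ln (real n)"
    by (simp add: filterlim_at_top)
  have "0 < \<eta> / 2" using \<eta> by simp
  note ev3 = all_row_dist2_lower_bound[OF this]
  show ?thesis
    using ev1 ev2 ev3 eventually_ge_at_top[of 256]
  proof eventually_elim
    case (elim n)
    interpret Q: prob_space "ensemble n" by (rule prob_space_ensemble)
    have n1: "1 \<le> n" using elim by simp
    define J where "J = {i\<in>{..<n}. \<delta> * real n \<le> real n - real i}"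
    define E where "E i = {X \<in> space (ensemble n). row_dist2 n X i \<le> \<delta> * real n / 2}" for i
    define A where "A = {X \<in> space (ensemble n). \<delta> * real n \<le> (\<Sum>i\<in>J. indicat_real (E i) X)}"
    define B where "B = {X \<in> space (ensemble n). \<exists>i<n. row_dist2 n X i \<le> 1 / (256 * real n ^ 8)}"
    define G where "G = {X \<in> space (ensemble n). real n powr ((1 - 2 * \<epsilon>) * real n) \<le> (\<Prod>i<n. row_dist2 n X i)}"
    have A: "A \<in> sets (ensemble n)" "Q.prob A \<le> 12 * K / (\<delta>\<^sup>2 * real n)"
      unfolding A_def J_def E_def by (rule many_small_rows[OF \<delta> n1])+
    have "B = (\<Union>i<n. {X \<in> space (ensemble n). row_dist2 n X i \<le> 1 / (256 * real n ^ 8)})"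
      by (auto simp: B_def)
    also have "\<dots> \<in> sets (ensemble n)" by (intro sets.finite_UN sets_row_dist2_le) auto
    finally have B: "B \<in> sets (ensemble n)" .
    have "(\<lambda>X. \<Prod>i<n. row_dist2 n X i) \<in> borel_measurable (ensemble n)"
      by (intro borel_measurable_prod measurable_row_dist2) simp
    then have G: "G \<in> sets (ensemble n)" unfolding G_def by measurable
    have "space (ensemble n) - G \<subseteq> A \<union> B"
    proof
      fix X assume X: "X \<in> space (ensemble n) - G"
      show "X \<in> A \<union> B"
      proof (rule ccontr)
        assume "X \<notin> A \<union> B"
        then have XA: "(\<Sum>i\<in>J. indicat_real (E i) X) < \<delta> * real n"
          and XB: "\<And>i. i < n \<Longrightarrow> 1 / (256 * real n ^ 8) < row_dist2 n X i"
          using X unfolding A_def B_def by (auto simp: not_le)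
        have "(\<Sum>i\<in>J. indicat_real (E i) X) = (\<Sum>i\<in>J. if X \<in> E i then 1 else 0)"
          by (intro sum.cong refl) (simp add: indicator_def)
        also have "\<dots> = real (card {i \<in> J. X \<in> E i})"
          by (simp add: J_def sum.If_cases Int_def)
        finally have c1: "real (card {i \<in> J. X \<in> E i}) \<le> \<delta> * real n" using XA by simp
        have c2: "real (card {i \<in> {..<n}. real n - real i < \<delta> * real n}) \<le> \<delta> * real n"
          using \<delta> by (intro card_last_indices) simp
        have "{i \<in> {..<n}. row_dist2 n X i \<le> \<delta> * real n / 2} \<subseteq>
            {i \<in> J. X \<in> E i} \<union> {i \<in> {..<n}. real n - real i < \<delta> * real n}"
          using X by (auto simp: J_def E_def)
        then have "card {i \<in> {..<n}. row_dist2 n X i \<le> \<delta> * real n / 2} \<le>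
            card ({i \<in> J. X \<in> E i} \<union> {i \<in> {..<n}. real n - real i < \<delta> * real n})"
          by (intro card_mono) (auto simp: J_def)
        also have "\<dots> \<le> card {i \<in> J. X \<in> E i} + card {i \<in> {..<n}. real n - real i < \<delta> * real n}"
          by (rule card_Un_le)
        finally have "real (card {i \<in> {..<n}. row_dist2 n X i \<le> \<delta> * real n / 2}) \<le> \<delta> * real n + \<delta> * real n"
          using c1 c2 by linarith
        then have "real (card {i \<in> {..<n}. row_dist2 n X i \<le> \<epsilon> / 20 * real n / 2}) \<le> \<epsilon> / 10 * real n"
          unfolding \<delta>_def by simp
        from prod_lower_bound_few_small[OF \<epsilon> elim(4) elim(2) XB this] show False
          using X unfolding G_def by blast
      qed
    qed
    then have "Q.prob (space (ensemble n) - G) \<le> Q.prob (A \<union> B)"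
      by (rule Q.finite_measure_mono[OF _ sets.Un[OF A(1) B]])
    also have "\<dots> \<le> Q.prob A + Q.prob B" by (rule measure_Un_le[OF A(1) B])
    also have "\<dots> \<le> \<eta>" using A(2) elim(1) elim(3)[folded B_def] by linarith
    finally have "1 - \<eta> \<le> Q.prob G" using Q.prob_compl[OF G] by linarith
    then show ?case unfolding G_def .
  qed
qed

end

text \<open>Independence of the entries is used twice to match the nested product: within one row it
  identifies the law of the row, and grouped by rows it makes the rows independent. With n >= 1 the
  index sets are nonempty, as the characterization of independence by product laws requires.\<close>

lemma (in prob_space) distr_matrix_eq_PiM:
  fixes \<xi> :: "nat \<Rightarrow> nat \<Rightarrow> 'a \<Rightarrow> real" and \<mu> :: "real measure"
  assumes ind: "indep_vars (\<lambda>_. borel) (\<lambda>(i, j). \<xi> i j) ({..<n} \<times> {..<n})"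
    and dist: "\<And>i j. i < n \<Longrightarrow> j < n \<Longrightarrow> distr M borel (\<xi> i j) = \<mu>"
    and n: "1 \<le> n"
  defines "Y \<equiv> (\<lambda>\<omega>. \<lambda>i\<in>{..<n}. \<lambda>j\<in>{..<n}. \<xi> i j \<omega>)"
  shows "distr M (PiM {..<n} (\<lambda>_. PiM {..<n} (\<lambda>_. borel))) Y = PiM {..<n} (\<lambda>_. PiM {..<n} (\<lambda>_. \<mu>))"
    and "Y \<in> M \<rightarrow>\<^sub>M PiM {..<n} (\<lambda>_. PiM {..<n} (\<lambda>_. borel))"
proof -
  let ?R = "PiM {..<n} (\<lambda>_::nat. borel :: real measure)"
  have "0 \<in> {..<n}" using n by simp
  then have ne: "{..<n} \<noteq> {}" by blast
  have rv[measurable]: "\<xi> i j \<in> borel_measurable M" if "i < n" "j < n" for i j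
    using ind that unfolding indep_vars_def2 by auto
  have rowm: "(\<lambda>\<omega>. \<lambda>j\<in>{..<n}. \<xi> i j \<omega>) \<in> M \<rightarrow>\<^sub>M ?R" if "i < n" for i
    using that by (intro measurable_restrict) auto
  show Ym: "Y \<in> M \<rightarrow>\<^sub>M PiM {..<n} (\<lambda>_. ?R)"
    unfolding Y_def by (intro measurable_restrict rowm) simp
  have row: "distr M ?R (\<lambda>\<omega>. \<lambda>j\<in>{..<n}. \<xi> i j \<omega>) = PiM {..<n} (\<lambda>_. \<mu>)" if i: "i < n" for i
  proof -
    have "indep_vars (\<lambda>j. PiM {(i, j)} (\<lambda>_. borel))
        (\<lambda>j \<omega>. restrict (\<lambda>z. (case z of (i, j) \<Rightarrow> \<xi> i j) \<omega>) {(i, j)}) {..<n}"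
      by (rule indep_vars_restrict[OF ind]) (use i in \<open>auto simp: disjoint_family_on_def\<close>)
    then have "indep_vars (\<lambda>_. borel)
        (\<lambda>j \<omega>. (\<lambda>x. x (i, j)) (restrict (\<lambda>z. (case z of (i, j) \<Rightarrow> \<xi> i j) \<omega>) {(i, j)})) {..<n}"
      by (rule indep_vars_compose2) (auto intro!: measurable_component_singleton)
    then have "indep_vars (\<lambda>_. borel) (\<xi> i) {..<n}" by simp
    then have "distr M ?R (\<lambda>\<omega>. \<lambda>j\<in>{..<n}. \<xi> i j \<omega>) = PiM {..<n} (\<lambda>j. distr M borel (\<xi> i j))"
      by (subst (asm) indep_vars_iff_distr_eq_PiM'[OF ne]) (use rv i in auto)
    also have "\<dots> = PiM {..<n} (\<lambda>_. \<mu>)" by (intro PiM_cong) (use dist i in auto)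
    finally show ?thesis .
  qed
  have "indep_vars (\<lambda>i. PiM ({i} \<times> {..<n}) (\<lambda>_. borel))
      (\<lambda>i \<omega>. restrict (\<lambda>z. (case z of (i, j) \<Rightarrow> \<xi> i j) \<omega>) ({i} \<times> {..<n})) {..<n}"
    by (rule indep_vars_restrict[OF ind]) (auto simp: disjoint_family_on_def)
  then have "indep_vars (\<lambda>_. ?R)
      (\<lambda>i \<omega>. (\<lambda>x. \<lambda>j\<in>{..<n}. x (i, j)) (restrict (\<lambda>z. (case z of (i, j) \<Rightarrow> \<xi> i j) \<omega>) ({i} \<times> {..<n}))) {..<n}"
    by (rule indep_vars_compose2) (rule measurable_restrict, rule measurable_component_singleton, simp)
  also have "?this \<longleftrightarrow> indep_vars (\<lambda>_. ?R) (\<lambda>i \<omega>. \<lambda>j\<in>{..<n}. \<xi> i j \<omega>) {..<n}"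
    by (intro indep_vars_cong refl ext) (auto simp: restrict_def)
  finally have "indep_vars (\<lambda>_. ?R) (\<lambda>i \<omega>. \<lambda>j\<in>{..<n}. \<xi> i j \<omega>) {..<n}" .
  then have "distr M (PiM {..<n} (\<lambda>_. ?R)) Y = PiM {..<n} (\<lambda>i. distr M ?R (\<lambda>\<omega>. \<lambda>j\<in>{..<n}. \<xi> i j \<omega>))"
    unfolding Y_def by (subst (asm) indep_vars_iff_distr_eq_PiM'[OF ne]) (use rowm in auto)
  also have "\<dots> = PiM {..<n} (\<lambda>_. PiM {..<n} (\<lambda>_. \<mu>))" by (intro PiM_cong) (use row in auto)
  finally show "distr M (PiM {..<n} (\<lambda>_. ?R)) Y = PiM {..<n} (\<lambda>_. PiM {..<n} (\<lambda>_. \<mu>))" .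
qed

lemma det_restrict:
  "Determinant.det (mat n n (\<lambda>(i, j). (\<lambda>i\<in>{..<n}. \<lambda>j\<in>{..<n}. x i j) i j)) = Determinant.det (mat n n (\<lambda>(i, j). x i j))"
  by (intro arg_cong[where f=Determinant.det] eq_matI) auto

text \<open>Turns a statement for every fixed e into one with a null sequence: at stage n the best e
  = 1/(k + 1) with k <= n that already works is used. The same sequence bounds both the exponent and
  the exceptional probability.\<close>

lemma diagonal_choice:
  fixes p :: "nat \<Rightarrow> real \<Rightarrow> real"
  assumes nonneg: "\<And>n e. 0 \<le> p n e"
    and ev: "\<And>e. 0 < e \<Longrightarrow> e \<le> 1 \<Longrightarrow> \<forall>\<^sub>F n in sequentially. 1 - e \<le> p n e"
  shows "\<exists>\<epsilon>. \<epsilon> \<longlonglongrightarrow> 0 \<and> (\<forall>n. 1 - \<epsilon> n \<le> p n (\<epsilon> n))"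
proof -
  \<comment> \<open>The index 0 always belongs to \<open>S n\<close>, since e = 1 asks only for
    \<open>0 \<le> p n 1\<close>; the cap \<open>k \<le> n\<close> keeps the set finite.\<close>
  define S where "S n = {k. k \<le> n \<and> 1 - 1 / real (Suc k) \<le> p n (1 / real (Suc k))}" for n
  define k where "k n = Max (S n)" for n
  have S: "finite (S n)" "0 \<in> S n" for n
    using nonneg by (auto simp: S_def)
  have kS: "k n \<in> S n" for n unfolding k_def using S[of n] by (intro Max_in) auto
  have "filterlim k at_top sequentially"
    unfolding filterlim_at_top
  proof
    fix Z
    have "\<forall>\<^sub>F n in sequentially. 1 - 1 / real (Suc Z) \<le> p n (1 / real (Suc Z))" by (rule ev) auto
    then show "\<forall>\<^sub>F n in sequentially. Z \<le> k n"
      using eventually_ge_at_top[of Z]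
    proof eventually_elim
      case (elim n)
      then have "Z \<in> S n" by (simp add: S_def)
      then show ?case unfolding k_def using S by simp
    qed
  qed
  then have "(\<lambda>n. 1 / real (Suc (k n))) \<longlonglongrightarrow> 0"
    by (rule filterlim_compose[OF LIMSEQ_Suc[OF lim_1_over_n]])
  moreover have "1 - 1 / real (Suc (k n)) \<le> p n (1 / real (Suc (k n)))" for n
    using kS[of n] by (simp add: S_def)
  ultimately show ?thesis by blast
qed

theorem theorem8p9:
  fixes P :: "nat \<Rightarrow> 'a measure"
    and \<xi> :: "nat \<Rightarrow> nat \<Rightarrow> nat \<Rightarrow> 'a \<Rightarrow> real"
    and \<mu> :: "real measure"
  assumes prob_space: "\<And>n. prob_space (P n)"
    and independent: "\<And>n. prob_space.indep_vars (P n) (\<lambda>_. borel) (\<lambda>(i, j). \<xi> n i j) ({..<n} \<times> {..<n})"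
    and identically_distributed: "\<And>n i j. i < n \<Longrightarrow> j < n \<Longrightarrow> distr (P n) borel (\<xi> n i j) = \<mu>"
    and mean_zero: "\<And>n i j. i < n \<Longrightarrow> j < n \<Longrightarrow> prob_space.expectation (P n) (\<xi> n i j) = 0"
    and variance_one: "\<And>n i j. i < n \<Longrightarrow> j < n \<Longrightarrow> prob_space.variance (P n) (\<xi> n i j) = 1"
    and finite_fourth_moment: "\<And>n i j. i < n \<Longrightarrow> j < n \<Longrightarrow> integrable (P n) (\<lambda>\<omega>. \<xi> n i j \<omega> ^ 4)"
  shows "\<exists>\<epsilon> \<delta> :: nat \<Rightarrow> real. \<epsilon> \<longlonglongrightarrow> 0 \<and> \<delta> \<longlonglongrightarrow> 0 \<and>
    (\<forall>n\<ge>1. measure (P n) {\<omega> \<in> space (P n).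
        \<bar>Determinant.det (mat n n (\<lambda>(i, j). \<xi> n i j \<omega>))\<bar> \<ge> real n powr ((1 / 2 - \<epsilon> n) * real n)}
      \<ge> 1 - \<delta> n)"
proof -
  have law: "entry_law \<mu>"
  proof -
    \<comment> \<open>The law is the same for every n, so its moments can be read off from the
      single entry of the 1 x 1 matrix.\<close>
    interpret P1: prob_space "P 1" by (rule prob_space)
    let ?X = "\<xi> 1 0 0"
    have X[measurable]: "?X \<in> borel_measurable (P 1)"
      using independent[of 1] unfolding P1.indep_vars_def2 by auto
    have \<mu>: "\<mu> = distr (P 1) borel ?X" using identically_distributed[of 0 1 0] by simp
    have mean: "P1.expectation ?X = 0" using mean_zero[of 0 1 0] by simp
    have var: "P1.expectation (\<lambda>\<omega>. (?X \<omega>)\<^sup>2) = 1" using variance_one[of 0 1 0] mean by simp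
    have four: "integrable (P 1) (\<lambda>\<omega>. ?X \<omega> ^ 4)" using finite_fourth_moment[of 0 1 0] by simp
    interpret D: prob_space \<mu> unfolding \<mu> by (rule P1.prob_space_distr[OF X])
    show ?thesis
    proof
      show "sets \<mu> = sets borel" by (simp add: \<mu>)
      show "(\<integral>y. y \<partial>\<mu>) = 0" unfolding \<mu> by (subst integral_distr) (use mean X in auto)
      show "(\<integral>y. y\<^sup>2 \<partial>\<mu>) = 1" unfolding \<mu> by (subst integral_distr) (use var X in auto)
      show "integrable \<mu> (\<lambda>y. y ^ 4)" unfolding \<mu> by (subst integrable_distr_eq) (use four X in auto)
    qed
  qed
  note prob_space_P = prob_space
  interpret entry_law \<mu> by (rule law)
  define p where "p n e = measure (P n) {\<omega> \<in> space (P n).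
      \<bar>Determinant.det (mat n n (\<lambda>(i, j). \<xi> n i j \<omega>))\<bar> \<ge> real n powr ((1 / 2 - e) * real n)}" for n e
  have ensemble: "p n e = measure (ensemble n)
      {X \<in> space (ensemble n). real n powr ((1 - 2 * e) * real n) \<le> (\<Prod>i<n. row_dist2 n X i)}"
    if n: "1 \<le> n" for n e
  proof -
    interpret Pn: prob_space "P n" by (rule prob_space_P)
    define N where "N = PiM {..<n} (\<lambda>_::nat. PiM {..<n} (\<lambda>_::nat. borel :: real measure))"
    define Y where "Y = (\<lambda>\<omega>. \<lambda>i\<in>{..<n}. \<lambda>j\<in>{..<n}. \<xi> n i j \<omega>)"
    define G where "G = {X \<in> space (ensemble n). real n powr ((1 - 2 * e) * real n) \<le> (\<Prod>i<n. row_dist2 n X i)}"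
    have Y: "distr (P n) N Y = ensemble n" "Y \<in> P n \<rightarrow>\<^sub>M N"
      unfolding N_def Y_def
      by (rule Pn.distr_matrix_eq_PiM[OF independent identically_distributed n]; assumption)+
    have "(\<lambda>X. \<Prod>i<n. row_dist2 n X i) \<in> borel_measurable (ensemble n)"
      by (intro borel_measurable_prod measurable_row_dist2) simp
    then have G: "G \<in> sets (ensemble n)" unfolding G_def by measurable
    have sets: "sets (ensemble n) = sets N" unfolding Y(1)[symmetric] by (rule sets_distr)
    have "measure (ensemble n) G = measure (P n) (Y -` G \<inter> space (P n))"
      unfolding Y(1)[symmetric] by (rule measure_distr[OF Y(2)]) (use G sets in simp)
    also have "Y -` G \<inter> space (P n) = {\<omega> \<in> space (P n).
        \<bar>Determinant.det (mat n n (\<lambda>(i, j). \<xi> n i j \<omega>))\<bar> \<ge> real n powr ((1 / 2 - e) * real n)}"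
    proof -
      have "Y \<omega> \<in> space (ensemble n)" if "\<omega> \<in> space (P n)" for \<omega>
        using measurable_space[OF Y(2) that] sets_eq_imp_space_eq[OF sets] by simp
      \<comment> \<open>The product is the square of the determinant, so the exponent 1/2 - e
        doubles to 1 - 2 e.\<close>
      moreover have "real n powr ((1 - 2 * e) * real n) \<le> (\<Prod>i<n. row_dist2 n (Y \<omega>) i) \<longleftrightarrow>
          real n powr ((1 / 2 - e) * real n) \<le> \<bar>Determinant.det (mat n n (\<lambda>(i, j). \<xi> n i j \<omega>))\<bar>" for \<omega>
      proof -
        have "(\<Prod>i<n. row_dist2 n (Y \<omega>) i) = (Determinant.det (mat n n (\<lambda>(i, j). \<xi> n i j \<omega>)))\<^sup>2"
          unfolding det_square_eq_prod_row_dist2[symmetric] Y_def det_restrict ..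
        moreover have "real n powr ((1 - 2 * e) * real n) = (real n powr ((1 / 2 - e) * real n))\<^sup>2"
          unfolding power2_eq_square powr_add[symmetric] by (simp add: algebra_simps)
        ultimately show ?thesis by (simp add: abs_le_square_iff[symmetric])
      qed
      ultimately show ?thesis unfolding G_def by blast
    qed
    finally show ?thesis unfolding p_def G_def ..
  qed
  have "\<exists>\<epsilon>. \<epsilon> \<longlonglongrightarrow> 0 \<and> (\<forall>n. 1 - \<epsilon> n \<le> p n (\<epsilon> n))"
  proof (rule diagonal_choice)
    show "0 \<le> p n e" for n e by (simp add: p_def)
    show "\<forall>\<^sub>F n in sequentially. 1 - e \<le> p n e" if "0 < e" "e \<le> 1" for e
      using prod_row_dist2_lower_bound[OF that that(1)] eventually_ge_at_top[of 1]
      by eventually_elim (simp only: ensemble)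
  qed
  then show ?thesis unfolding p_def by blast
qed

end
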